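(* (Sum-rank Roos bound) Let $\mathbb E,\mathbb F,\mathbb K,\mathbb L,\sigma,\theta,m,\ell$ be as in the context, let $n=m\ell$, and let $\mathcal C\subseteq\mathbb F^n$ be a (nonzero) cyclic-skew-cyclic code with defining set $T_{\mathcal C}$. Let $r\ge 0$ and let $b,s,\delta,k_0,\dots,k_r$ be integers such that $\gcd(n,s)=1$, $k_i<k_{i+1}$ for $i=0,\dots,r-1$, and $k_r-k_0\le\delta+r-2$. Let $a\in\mathbb K$ be a primitive $\ell$-th root of unity and let $\beta$ be a normal element of $\mathbb L/\mathbb K$. If $$\{(a^{b+si+k_j},\sigma^{si+k_j}(\beta))\in\mathbb K\times\mathbb L^*:\ 0\le i\le\delta-2,\ 0\le j\le r\}\subseteq T_{\mathcal C},$$ then $\mathrm d_{\mathrm{srk}}(\mathcal C)\ge\delta+r$.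
   Context: Setting. $\mathbb K/\mathbb E$ and $\mathbb F/\mathbb E$ are field extensions (inside a common field) of finite degrees $h$ and $m$, with $\mathbb K\cap\mathbb F=\mathbb E$; $\mathbb L=\mathbb F\mathbb K$, with $[\mathbb L:\mathbb F]=h$ and $[\mathbb L:\mathbb K]=m$. $\mathbb L/\mathbb K$ is a cyclic Galois extension, $\sigma\in\mathrm{Gal}(\mathbb L/\mathbb K)$, and $\theta=\sigma|_{\mathbb F}$ is an automorphism of $\mathbb F$ of order $m$ with fixed field $\mathbb E$ (so $\sigma$ generates $\mathrm{Gal}(\mathbb L/\mathbb K)$). $\ell$ is a positive integer such that $x^\ell-1$ has $\ell$ pairwise distinct roots, all in $\mathbb K$; moreover $\ell$ is coprime to $\mathrm{char}(\mathbb K)$ and to $m$. An element $\beta\in\mathbb L$ is normal if $\beta,\sigma(\beta),\dots,\sigma^{m-1}(\beta)$ is a $\mathbb K$-basis of $\mathbb L$. Sum-rank metric. Vectors $c\in\mathbb F^n$, $n=m\ell$, are split as $c=(c^{(0)}\mid\dots\mid c^{(\ell-1)})$ with $c^{(i)}=(c^{(i)}_0,\dots,c^{(i)}_{m-1})\in\mathbb F^m$. $\mathrm{wt}_{\mathrm{srk}}(c)=\sum_{i=0}^{\ell-1}\dim_{\mathbb E}\langle c^{(i)}_0,\dots,c^{(i)}_{m-1}\rangle_{\mathbb E}$. A code is an $\mathbb F$-linear subspace of $\mathbb F^n$, and $\mathrm d_{\mathrm{srk}}(\mathcal C)=\min\{\mathrm{wt}_{\mathrm{srk}}(c):c\in\mathcal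 C,c\ne0\}$. Cyclic-skew-cyclic codes. $\mathcal C$ is cyclic-skew-cyclic if $\rho(\mathcal C)\subseteq\mathcal C$ and $\phi(\mathcal C)\subseteq\mathcal C$, where $\rho(c^{(0)}\mid\dots\mid c^{(\ell-1)})=(c^{(\ell-1)}\mid c^{(0)}\mid\dots\mid c^{(\ell-2)})$ and $\phi$ applies to each block the map $\varphi(v_0,\dots,v_{m-1})=(\theta(v_{m-1}),\theta(v_0),\dots,\theta(v_{m-2}))$. For an automorphism $\tau$ of a ring $A$, $A[z;\tau]$ is the skew polynomial ring with $za=\tau(a)z$. Let $\mathcal S'=\mathbb F[x]/(x^\ell-1)$, with $\theta$ extended by $\theta(x)=x$, and $\mathcal R'=\mathcal S'[z;\theta]/(z^m-1)$. The bijection $\nu:\mathbb F^n\to\mathcal R'$, $\nu(c)=\sum_{j=0}^{m-1}\big(\sum_{i=0}^{\ell-1}c^{(i)}_jx^i\big)z^j$, identifies cyclic-skew-cyclic codes with left ideals of $\mathcal R'$, and under the present hypotheses every left ideal of $\mathcal R'$ is principal. Defining set. For $a\in\mathbb K$ with $a^\ell=1$, $\beta\in\mathbb L^*$ and $g(x,z)=\sum_j g_j(x)z^j$, put $\mathrm{Ev}_{a,\beta}(g)=\sum_j g_j(a)\sigma^j(\beta)\beta^{-1}\in\mathbb L$ (this is the evaluation at $x=a$ followed by the right-remainder evaluation at $z=\sigma(\beta)\beta^{-1}$, i.e. the remainder of right division by $z-\sigma(\beta)\beta^{-1}$ in $\mathbb L[z;\sigma]$). If $\nu(\mathcal C)$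 is the left ideal generated by $g(x,z)$, then $T_{\mathcal C}=\{(a,\beta)\in\mathbb K\times\mathbb L^*: a^\ell=1,\ \mathrm{Ev}_{a,\beta}(g)=0\}$. *)

theory Defs
  imports
    "HOL-Algebra.Algebra"
    "HOL-Algebra.Algebraic_Closure_Type"
    "Jordan_Normal_Form.Matrix"
begin

section \<open>Subfields of an ambient field\<close>

text \<open>All fields are subfields of one ambient field, which is a type \<open>'a :: field\<close>; the notions of
  HOL-Algebra apply to it through its ring record.\<close>

abbreviation ambient :: "'a::field ring" (\<open>\<Omega>\<close>)
  where "\<Omega> \<equiv> ring_of_type_algebra"

definition galois_group :: "'a::field set \<Rightarrow> 'a set \<Rightarrow> ('a \<Rightarrow> 'a) monoid"
  where "galois_group L K = (BijGroup L)\<lparr>carrier :=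
    {\<tau> \<in> Bij L. \<tau> \<in> ring_iso (\<Omega>\<lparr>carrier := L\<rparr>) (\<Omega>\<lparr>carrier := L\<rparr>) \<and> (\<forall>x\<in>K. \<tau> x = x)}\<rparr>"

definition galois_extension :: "'a::field set \<Rightarrow> 'a set \<Rightarrow> bool"
  where "galois_extension L K \<longleftrightarrow> ring.finite_dimension \<Omega> K L \<and>
    {x \<in> L. \<forall>\<tau>\<in>carrier (galois_group L K). \<tau> x = x} = K"

definition normal_element :: "'a::field set \<Rightarrow> 'a set \<Rightarrow> ('a \<Rightarrow> 'a) \<Rightarrow> nat \<Rightarrow> 'a \<Rightarrow> bool"
  where "normal_element K L \<sigma> m \<beta> \<longleftrightarrow> \<beta> \<in> L \<and>
    ring.independent \<Omega> K (map (\<lambda>j. (\<sigma> ^^ j) \<beta>) [0..<m]) \<and>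
    ring.Span \<Omega> K (map (\<lambda>j. (\<sigma> ^^ j) \<beta>) [0..<m]) = L"

definition primitive_root_of_unity :: "nat \<Rightarrow> 'a::field \<Rightarrow> bool"
  where "primitive_root_of_unity l a \<longleftrightarrow> a ^ l = 1 \<and> (\<forall>k. 0 < k \<and> k < l \<longrightarrow> a ^ k \<noteq> 1)"


section \<open>Sum-rank metric codes\<close>

text \<open>The entry \<open>c\<^sup>(\<^sup>i\<^sup>)\<^sub>j\<close> of a vector of length \<open>m * l\<close>, consisting of \<open>l\<close> blocks of length \<open>m\<close>.\<close>

definition entry :: "nat \<Rightarrow> 'a vec \<Rightarrow> nat \<Rightarrow> nat \<Rightarrow> 'a"
  where "entry m c i j = c $ (i * m + j)"

definition of_blocks :: "nat \<Rightarrow> nat \<Rightarrow> (nat \<Rightarrow> nat \<Rightarrow> 'a) \<Rightarrow> 'a vec"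
  where "of_blocks m l f = vec (m * l) (\<lambda>t. f (t div m) (t mod m))"

definition linear_code :: "'a::field set \<Rightarrow> nat \<Rightarrow> 'a vec set \<Rightarrow> bool"
  where "linear_code F n C \<longleftrightarrow>
    C \<subseteq> {c \<in> carrier_vec n. \<forall>t<n. c $ t \<in> F} \<and> 0\<^sub>v n \<in> C \<and>
    (\<forall>c\<in>C. \<forall>d\<in>C. c + d \<in> C) \<and> (\<forall>\<alpha>\<in>F. \<forall>c\<in>C. \<alpha> \<cdot>\<^sub>v c \<in> C)"

definition wt_srk :: "'a::field set \<Rightarrow> nat \<Rightarrow> nat \<Rightarrow> 'a vec \<Rightarrow> nat"
  where "wt_srk E m l c =
    (\<Sum>i<l. ring.dim \<Omega> E (ring.Span \<Omega> E (map (entry m c i) [0..<m])))"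

definition d_srk :: "'a::field set \<Rightarrow> nat \<Rightarrow> nat \<Rightarrow> 'a vec set \<Rightarrow> nat"
  where "d_srk E m l C = Inf {wt_srk E m l c | c. c \<in> C \<and> c \<noteq> 0\<^sub>v (m * l)}"

definition block_shift :: "nat \<Rightarrow> nat \<Rightarrow> 'a vec \<Rightarrow> 'a vec"
  where "block_shift m l c = of_blocks m l (\<lambda>i j. entry m c ((i + l - 1) mod l) j)"

definition skew_shift :: "('a \<Rightarrow> 'a) \<Rightarrow> nat \<Rightarrow> nat \<Rightarrow> 'a vec \<Rightarrow> 'a vec"
  where "skew_shift \<theta> m l c = of_blocks m l (\<lambda>i j. \<theta> (entry m c i ((j + m - 1) mod m)))"

definition cyclic_skew_cyclic ::
    "'a::field set \<Rightarrow> ('a \<Rightarrow> 'a) \<Rightarrow> nat \<Rightarrow> nat \<Rightarrow> 'a vec set \<Rightarrow> bool"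
  where "cyclic_skew_cyclic F \<theta> m l C \<longleftrightarrow> linear_code F (m * l) C \<and>
    block_shift m l ` C \<subseteq> C \<and> skew_shift \<theta> m l ` C \<subseteq> C"


section \<open>Skew polynomial rings and the ring containing the images of the codes\<close>

text \<open>The skew polynomial ring \<open>A[z; \<tau>]\<close> with \<open>z a = \<tau>(a) z\<close>; as in \<^const>\<open>UP\<close>, its elements are the
  finitely supported coefficient sequences.\<close>

definition skew_poly_ring :: "('b, 'c) ring_scheme \<Rightarrow> ('b \<Rightarrow> 'b) \<Rightarrow> (nat \<Rightarrow> 'b) ring"
  where "skew_poly_ring A \<tau> = \<lparr>
    carrier = up A,
    monoid.mult = (\<lambda>f g n. \<Oplus>\<^bsub>A\<^esub>i\<in>{..n}. f i \<otimes>\<^bsub>A\<^esub> (\<tau> ^^ i) (g (n - i))),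
    one = (\<lambda>n. if n = 0 then \<one>\<^bsub>A\<^esub> else \<zero>\<^bsub>A\<^esub>),
    ring.zero = (\<lambda>n. \<zero>\<^bsub>A\<^esub>),
    add = (\<lambda>f g n. f n \<oplus>\<^bsub>A\<^esub> g n)\<rparr>"

definition skew_var :: "('b, 'c) ring_scheme \<Rightarrow> nat \<Rightarrow> 'b"
  where "skew_var A = (\<lambda>n. if n = 1 then \<one>\<^bsub>A\<^esub> else \<zero>\<^bsub>A\<^esub>)"

text \<open>\<open>F[x]\<close>, the ideal \<open>(x\<^sup>l - 1)\<close>, the quotient \<open>S' = F[x]/(x\<^sup>l - 1)\<close> and the residue class map\<close>

definition polys_over :: "'a::field set \<Rightarrow> 'a poly ring"
  where "polys_over F = ring_of_type_algebra\<lparr>carrier := {p. \<forall>i. poly.coeff p i \<in> F}\<rparr>"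

definition S_ideal :: "'a::field set \<Rightarrow> nat \<Rightarrow> 'a poly set"
  where "S_ideal F l = Idl\<^bsub>polys_over F\<^esub> {Polynomial.monom 1 l - 1}"

definition S_ring :: "'a::field set \<Rightarrow> nat \<Rightarrow> 'a poly set ring"
  where "S_ring F l = polys_over F Quot S_ideal F l"

definition S_class :: "'a::field set \<Rightarrow> nat \<Rightarrow> 'a poly \<Rightarrow> 'a poly set"
  where "S_class F l p = S_ideal F l +>\<^bsub>polys_over F\<^esub> p"

text \<open>The extension of \<open>\<theta>\<close> to \<open>S'\<close> fixing \<open>x\<close>: the image of a residue class under the coefficientwise
  action of \<open>\<theta>\<close> is again a residue class.\<close>

definition S_aut :: "('a::field \<Rightarrow> 'a) \<Rightarrow> 'a poly set \<Rightarrow> 'a poly set"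
  where "S_aut \<theta> P = map_poly \<theta> ` P"

text \<open>\<open>R' = S'[z; \<theta>]/(z\<^sup>m - 1)\<close>\<close>

definition skew_S :: "'a::field set \<Rightarrow> ('a \<Rightarrow> 'a) \<Rightarrow> nat \<Rightarrow> (nat \<Rightarrow> 'a poly set) ring"
  where "skew_S F \<theta> l = skew_poly_ring (S_ring F l) (S_aut \<theta>)"

definition R_ideal :: "'a::field set \<Rightarrow> ('a \<Rightarrow> 'a) \<Rightarrow> nat \<Rightarrow> nat \<Rightarrow> (nat \<Rightarrow> 'a poly set) set"
  where "R_ideal F \<theta> m l = Idl\<^bsub>skew_S F \<theta> l\<^esub>
    {skew_var (S_ring F l) [^]\<^bsub>skew_S F \<theta> l\<^esub> m \<ominus>\<^bsub>skew_S F \<theta> l\<^esub> \<one>\<^bsub>skew_S F \<theta> l\<^esub>}"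

definition R_ring :: "'a::field set \<Rightarrow> ('a \<Rightarrow> 'a) \<Rightarrow> nat \<Rightarrow> nat \<Rightarrow> (nat \<Rightarrow> 'a poly set) set ring"
  where "R_ring F \<theta> m l = skew_S F \<theta> l Quot R_ideal F \<theta> m l"

text \<open>An expression \<open>g(x,z) = \<Sum>\<^sub>j g\<^sub>j(x) z\<^sup>j\<close> with \<open>g\<^sub>j \<in> F[x]\<close> is a polynomial in \<open>z\<close> with coefficients
  \<open>g\<^sub>j\<close>; only its coefficients are used, never the commutative multiplication of \<open>'a poly poly\<close>.
  \<open>R_class\<close> maps it to the element of \<open>R'\<close> that it denotes.\<close>

definition R_class ::
    "'a::field set \<Rightarrow> ('a \<Rightarrow> 'a) \<Rightarrow> nat \<Rightarrow> nat \<Rightarrow> 'a poly poly \<Rightarrow> (nat \<Rightarrow> 'a poly set) set"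
  where "R_class F \<theta> m l g =
    R_ideal F \<theta> m l +>\<^bsub>skew_S F \<theta> l\<^esub> (\<lambda>j. S_class F l (poly.coeff g j))"

definition nu :: "'a::field set \<Rightarrow> ('a \<Rightarrow> 'a) \<Rightarrow> nat \<Rightarrow> nat \<Rightarrow> 'a vec \<Rightarrow> (nat \<Rightarrow> 'a poly set) set"
  where "nu F \<theta> m l c = R_class F \<theta> m l
    (\<Sum>j<m. Polynomial.monom (\<Sum>i<l. Polynomial.monom (entry m c i j) i) j)"

text \<open>\<^term>\<open>PIdl\<^bsub>R\<^esub> a\<close> is by definition the set of left multiples of \<open>a\<close>, hence, in a
  noncommutative ring, the left ideal generated by \<open>a\<close>.\<close>

definition generates_code ::
    "'a::field set \<Rightarrow> ('a \<Rightarrow> 'a) \<Rightarrow> nat \<Rightarrow> nat \<Rightarrow> 'a poly poly \<Rightarrow> 'a vec set \<Rightarrow> bool"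
  where "generates_code F \<theta> m l g C \<longleftrightarrow>
    (\<forall>i j. poly.coeff (poly.coeff g j) i \<in> F) \<and>
    nu F \<theta> m l ` C = PIdl\<^bsub>R_ring F \<theta> m l\<^esub> (R_class F \<theta> m l g)"

definition Ev :: "('a::field \<Rightarrow> 'a) \<Rightarrow> 'a \<Rightarrow> 'a \<Rightarrow> 'a poly poly \<Rightarrow> 'a"
  where "Ev \<sigma> a \<beta> g =
    (\<Sum>j\<le>Polynomial.degree g. poly (poly.coeff g j) a * (\<sigma> ^^ j) \<beta> * inverse \<beta>)"

text \<open>The defining set of the code generated by \<open>g\<close>; it does not depend on the choice of \<open>g\<close>.\<close>

definition defining_set ::
    "'a::field set \<Rightarrow> 'a set \<Rightarrow> ('a \<Rightarrow> 'a) \<Rightarrow> nat \<Rightarrow> 'a poly poly \<Rightarrow> ('a \<times> 'a) set"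
  where "defining_set K L \<sigma> l g =
    {(a, \<beta>). a \<in> K \<and> \<beta> \<in> L - {0} \<and> a ^ l = 1 \<and> Ev \<sigma> a \<beta> g = 0}"

end

theory Submission
  imports Defs "HOL-Number_Theory.Cong"
begin

text \<open>A codeword, read as a skew polynomial, acts on \<open>L\<close> with \<open>z\<close> acting as \<open>\<sigma>\<close> and \<open>x\<close> as an
  \<open>l\<close>-th root of unity; the operators annihilating \<open>L\<close> form a two-sided ideal containing
  \<open>z\<^sup>m - 1\<close>, so the zeros of \<open>g\<close> are zeros of all codewords. Write the block \<open>t\<close> of a codeword as
  \<open>\<Sum>\<^sub>u y\<^sub>t\<^sub>u A\<^sub>t\<^sub>u\<close> with \<open>y\<^sub>t\<^sub>u\<close> an \<open>E\<close>-basis of the span of its entries and \<open>A\<^sub>t\<^sub>u \<in> E\<^sup>m\<close>. The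
  hypothesis on the defining set becomes a system of orthogonality relations between two
  generalized Moore matrices, one built from the \<open>y\<^sub>t\<^sub>u\<close> with the automorphism \<open>\<sigma>\<close> to the power
  \<open>- s\<close> and one from \<open>\<gamma>\<^sub>t\<^sub>u = \<Sum>\<^sub>j A\<^sub>t\<^sub>u\<^sub>j \<sigma>\<^sup>j(\<beta>)\<close> with \<open>\<sigma>\<close>. Their columns are indexed by the pairs
  \<open>(t, u)\<close>, whose number is the weight, and both matrices have maximal rank because the norms of
  distinct powers of \<open>a\<close> differ. The relations are then too numerous for a weight below
  \<open>\<delta> + r\<close>.\<close>


section \<open>Linear algebra over subfields of the ambient field\<close>

text \<open>The difficulty is the rank across blocks. Inside one block a matrix is an ordinary Moore
  matrix, whose rank is governed by linear independence over the fixed field \<open>K\<close>.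
  Between blocks only the scalars \<open>a ^ t\<close> differ. A nonzero \<open>w\<close> with
  \<open>\<sigma> w = a ^ (t - t') * w\<close> would tie block \<open>t\<close> to block
  \<open>t'\<close>; iterating \<open>m\<close> times gives equality of the norms
  \<open>a ^ (t * m)\<close> and \<open>a ^ (t' * m)\<close>, since \<open>a\<close> lies in
  \<open>K\<close>. As \<open>m\<close> and \<open>l\<close> are coprime, this forces
  \<open>t = t'\<close>, and the blocks behave like distinct nodes of a Vandermonde matrix. The
  fixed field is \<open>K\<close>, whereas the entries of a codeword are a priori independent only
  over \<open>E\<close>. Linear disjointness of \<open>F\<close> and \<open>K\<close> over
  \<open>E\<close> bridges the gap; it is itself a consequence of the rank theorem, applied to
  \<open>\<theta>\<close> on \<open>F\<close>. The power \<open>- s\<close> appears because undoing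
  \<open>\<sigma> ^^ (s * i)\<close> in the relation for \<open>(i, j)\<close> leaves
  \<open>i\<close> only in the factor from the codeword and \<open>j\<close> only in the factor from
  the normal element. Coprimality of \<open>s\<close> to \<open>m\<close> preserves the fixed field,
  and coprimality to \<open>l\<close> keeps the norms distinct.\<close>

lemma ambient_simps [simp]:
  "carrier \<Omega> = UNIV" "\<zero>\<^bsub>\<Omega>\<^esub> = 0"
  "\<one>\<^bsub>\<Omega>\<^esub> = 1" "x \<oplus>\<^bsub>\<Omega>\<^esub> y = x + y" "x \<otimes>\<^bsub>\<Omega>\<^esub> y = x * y"
  by (simp_all add: ring_of_type_algebra_def)

lemma a_inv_ambient [simp]: "\<ominus>\<^bsub>\<Omega>\<^esub> x = - x" for x :: "'a::field"
proof -
  interpret R: field "\<Omega> :: 'a ring" by (rule field_from_type_algebra)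
  show ?thesis by (rule R.minus_equality) auto
qed

lemma m_inv_ambient [simp]: "x \<noteq> 0 \<Longrightarrow> inv\<^bsub>\<Omega>\<^esub> x = inverse x" for x :: "'a::field"
proof -
  interpret R: field "\<Omega> :: 'a ring" by (rule field_from_type_algebra)
  show "x \<noteq> 0 \<Longrightarrow> ?thesis" by (rule R.comm_inv_char) auto
qed

lemma subfield_ambient_closed:
  fixes L :: "'a::field set"
  assumes "subfield L \<Omega>"
  shows "0 \<in> L" "1 \<in> L" "\<And>x y. x \<in> L \<Longrightarrow> y \<in> L \<Longrightarrow> x + y \<in> L"
    "\<And>x y. x \<in> L \<Longrightarrow> y \<in> L \<Longrightarrow> x * y \<in> L" "\<And>x. x \<in> L \<Longrightarrow> - x \<in> L"
    "\<And>x. x \<in> L \<Longrightarrow> inverse x \<in> L"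
proof -
  interpret R: field "\<Omega> :: 'a ring" by (rule field_from_type_algebra)
  note sr = subringE[OF subfieldE(1)[OF assms]]
  show "0 \<in> L" "1 \<in> L" "\<And>x y. x \<in> L \<Longrightarrow> y \<in> L \<Longrightarrow> x + y \<in> L"
    "\<And>x y. x \<in> L \<Longrightarrow> y \<in> L \<Longrightarrow> x * y \<in> L" "\<And>x. x \<in> L \<Longrightarrow> - x \<in> L"
    using sr by auto
  show "inverse x \<in> L" if "x \<in> L" for x
    using R.subfield_m_inv(1)[OF assms, of x] that \<open>0 \<in> L\<close> by (cases "x = 0") auto
qed

locale ambient_subfield =
  fixes L :: "'a::field set"
  assumes subfield: "subfield L \<Omega>"
begin

lemmas closed [simp, intro] = subfield_ambient_closed[OF subfield]

lemma diff_closed [simp, intro]: "x \<in> L \<Longrightarrow> y \<in> L \<Longrightarrow> x - y \<in> L"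
  using closed(3)[of x "- y"] by simp

lemma divide_closed [simp, intro]: "x \<in> L \<Longrightarrow> y \<in> L \<Longrightarrow> x / y \<in> L"
  by (simp add: divide_inverse)

lemma power_closed [simp, intro]: "x \<in> L \<Longrightarrow> x ^ i \<in> L"
  by (induction i) auto

lemma sum_closed [simp, intro]: "(\<And>i. i \<in> A \<Longrightarrow> f i \<in> L) \<Longrightarrow> sum f A \<in> L"
  by (induction A rule: infinite_finite_induct) auto

text \<open>Gaussian elimination, one equation at a time: a nonzero coefficient at \<open>p0\<close>
  serves as pivot, so one equation and one unknown disappear together and the strict inequality of
  cardinalities survives. All operations stay in \<open>L\<close>, hence so does the
  solution.\<close>

lemma homogeneous_system_solution:
  fixes M :: "'q \<Rightarrow> 'p \<Rightarrow> 'a"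
  assumes "finite Q" "finite P" "card Q < card P"
    and "\<And>q p. q \<in> Q \<Longrightarrow> p \<in> P \<Longrightarrow> M q p \<in> L"
  obtains x where "\<And>p. p \<in> P \<Longrightarrow> x p \<in> L" "\<exists>p\<in>P. x p \<noteq> 0"
    "\<And>q. q \<in> Q \<Longrightarrow> (\<Sum>p\<in>P. M q p * x p) = 0"
proof -
  have "\<exists>x. (\<forall>p\<in>P. x p \<in> L) \<and> (\<exists>p\<in>P. x p \<noteq> 0) \<and> (\<forall>q\<in>Q. (\<Sum>p\<in>P. M q p * x p) = 0)"
    using assms
  proof (induction Q arbitrary: P M rule: finite_induct)
    case empty
    then have "P \<noteq> {}" by auto
    then show ?case by (intro exI[of _ "\<lambda>_. 1"]) auto
  next
    case (insert q Q)
    show ?case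
    proof (cases "\<forall>p\<in>P. M q p = 0")
      case True
      have "card Q < card P" using insert.prems insert.hyps by simp
      from insert.IH[OF insert.prems(1) this, of M] insert.prems(3) True
      show ?thesis by auto
    next
      case False
      then obtain p0 where p0: "p0 \<in> P" "M q p0 \<noteq> 0" by auto
      \<comment> \<open>Row \<open>q'\<close> after clearing its entry at \<open>p0\<close> with the
        pivot row \<open>q\<close>; the value of \<open>y\<close> at \<open>p0\<close> below is then
        dictated by row \<open>q\<close>.\<close>
      define M' where "M' q' p = M q' p - M q' p0 * M q p / M q p0" for q' p
      have "\<exists>x. (\<forall>p\<in>P - {p0}. x p \<in> L) \<and> (\<exists>p\<in>P - {p0}. x p \<noteq> 0) \<and>
          (\<forall>q'\<in>Q. (\<Sum>p\<in>P - {p0}. M' q' p * x p) = 0)"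
        using insert.prems insert.hyps p0 by (intro insert.IH) (auto simp: M'_def)
      then obtain x where x: "\<And>p. p \<in> P - {p0} \<Longrightarrow> x p \<in> L" "\<exists>p\<in>P - {p0}. x p \<noteq> 0"
        "\<And>q'. q' \<in> Q \<Longrightarrow> (\<Sum>p\<in>P - {p0}. M' q' p * x p) = 0" by blast
      define S where "S = (\<Sum>p\<in>P - {p0}. M q p * x p)"
      define y where "y p = (if p = p0 then - S / M q p0 else x p)" for p
      have SL: "S \<in> L" unfolding S_def using x(1) insert.prems(3) by (intro sum_closed) auto
      have split: "(\<Sum>p\<in>P. f p * y p) = f p0 * (- S / M q p0) + (\<Sum>p\<in>P - {p0}. f p * x p)" for f
      proof -
        have "(\<Sum>p\<in>P. f p * y p) = f p0 * y p0 + (\<Sum>p\<in>P - {p0}. f p * y p)"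
          using insert.prems(1) p0(1) by (simp add: sum.remove)
        also have "(\<Sum>p\<in>P - {p0}. f p * y p) = (\<Sum>p\<in>P - {p0}. f p * x p)"
          by (intro sum.cong) (auto simp: y_def)
        finally show ?thesis by (simp add: y_def)
      qed
      have "(\<Sum>p\<in>P. M q' p * y p) = 0" if "q' \<in> insert q Q" for q'
      proof (cases "q' = q")
        case True
        then show ?thesis using p0(2) split[of "M q"] by (simp add: S_def)
      next
        case False
        then have "0 = (\<Sum>p\<in>P - {p0}. M' q' p * x p)" using x(3) that by auto
        also have "\<dots> = (\<Sum>p\<in>P - {p0}. M q' p * x p) - M q' p0 / M q p0 * S"
          unfolding M'_def S_def sum_distrib_left sum_subtractf[symmetric]
          by (intro sum.cong) (auto simp: algebra_simps)
        finally show ?thesis using split[of "M q'"] by simp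
      qed
      moreover have "\<forall>p\<in>P. y p \<in> L"
        using x(1) SL p0 insert.prems(3) by (auto simp: y_def)
      moreover have "\<exists>p\<in>P. y p \<noteq> 0" using x(2) by (auto simp: y_def)
      ultimately show ?thesis by blast
    qed
  qed
  then show thesis using that by blast
qed

text \<open>Greedy selection: \<open>m\<close> joins \<open>B\<close> exactly when
  \<open>v m\<close> is not a combination of the vectors already selected. \<open>A u j\<close> is
  the coordinate of \<open>v j\<close> at \<open>v u\<close>.\<close>

lemma ex_basis_subfamily:
  fixes v :: "nat \<Rightarrow> 'a"
  shows "\<exists>B A. B \<subseteq> {..<m} \<and> (\<forall>u j. A u j \<in> L) \<and>
    (\<forall>u\<in>B. \<forall>j\<in>B. A u j = (if u = j then 1 else 0)) \<and>
    (\<forall>j<m. v j = (\<Sum>u\<in>B. A u j * v u)) \<and>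
    (\<forall>c. (\<forall>u\<in>B. c u \<in> L) \<longrightarrow> (\<Sum>u\<in>B. c u * v u) = 0 \<longrightarrow> (\<forall>u\<in>B. c u = 0))"
proof (induction m)
  case 0
  show ?case by (intro exI[of _ "{}"] exI[of _ "\<lambda>_ _. 0"]) auto
next
  case (Suc m)
  then obtain B A where B: "B \<subseteq> {..<m}" "\<forall>u j. A u j \<in> L"
    "\<forall>u\<in>B. \<forall>j\<in>B. A u j = (if u = j then 1 else 0)"
    "\<forall>j<m. v j = (\<Sum>u\<in>B. A u j * v u)"
    "\<forall>c. (\<forall>u\<in>B. c u \<in> L) \<longrightarrow> (\<Sum>u\<in>B. c u * v u) = 0 \<longrightarrow> (\<forall>u\<in>B. c u = 0)"
    by (elim exE conjE)
  have fB: "finite B" "m \<notin> B" using B(1) finite_subset by auto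
  show ?case
  proof (cases "\<exists>c. (\<forall>u\<in>B. c u \<in> L) \<and> v m = (\<Sum>u\<in>B. c u * v u)")
    case True
    then obtain c where c: "\<And>u. u \<in> B \<Longrightarrow> c u \<in> L" "v m = (\<Sum>u\<in>B. c u * v u)" by blast
    define A' where "A' u j = (if j = m then (if u \<in> B then c u else 0) else A u j)" for u j
    show ?thesis
    proof (intro exI[of _ B] exI[of _ A'] conjI)
      show "\<forall>j<Suc m. v j = (\<Sum>u\<in>B. A' u j * v u)"
      proof (intro allI impI)
        fix j assume j: "j < Suc m"
        have "v j = (\<Sum>u\<in>B. (if j = m then c u else A u j) * v u)"
        proof (cases "j = m")
          case True
          then show ?thesis using c(2) by simp
        next
          case False
          then have "v j = (\<Sum>u\<in>B. A u j * v u)" using j by (intro B(4)[rule_format]) simp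
          then show ?thesis using False by (simp only: if_False)
        qed
        also have "\<dots> = (\<Sum>u\<in>B. A' u j * v u)"
          by (intro sum.cong) (auto simp: A'_def)
        finally show "v j = (\<Sum>u\<in>B. A' u j * v u)" .
      qed
      show "B \<subseteq> {..<Suc m}" using B(1) by auto
      show "\<forall>u j. A' u j \<in> L" using B(2) c(1) by (simp add: A'_def)
      show "\<forall>u\<in>B. \<forall>j\<in>B. A' u j = (if u = j then 1 else 0)"
      proof (intro ballI)
        fix u j assume uj: "u \<in> B" "j \<in> B"
        then have "j \<noteq> m" using fB(2) by auto
        then show "A' u j = (if u = j then 1 else 0)" using B(3) uj by (simp add: A'_def)
      qed
    qed (rule B(5))
  next
    case False
    define A' where "A' u j = (if u = m then (if j = m then 1 else 0)
      else if j = m then 0 else A u j)" for u j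
    have indep: "\<forall>u\<in>insert m B. c u = 0"
      if c: "\<forall>u\<in>insert m B. c u \<in> L" "(\<Sum>u\<in>insert m B. c u * v u) = 0" for c
    proof -
      have eq: "c m * v m + (\<Sum>u\<in>B. c u * v u) = 0" using c(2) fB by simp
      have "c m = 0"
      proof (rule ccontr)
        assume "c m \<noteq> 0"
        have "(\<Sum>u\<in>B. (- c u / c m) * v u) = - (\<Sum>u\<in>B. c u * v u) / c m"
          by (simp add: sum_divide_distrib sum_negf)
        also have "\<dots> = v m"
          using \<open>c m \<noteq> 0\<close> minus_unique[OF eq[unfolded add.commute[of "c m * v m"]]] by simp
        finally have "v m = (\<Sum>u\<in>B. (- c u / c m) * v u)" by (rule sym)
        moreover have "\<forall>u\<in>B. - c u / c m \<in> L" using c(1) by auto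
        ultimately have "\<exists>c. (\<forall>u\<in>B. c u \<in> L) \<and> v m = (\<Sum>u\<in>B. c u * v u)"
          by (intro exI[of _ "\<lambda>u. - c u / c m"] conjI)
        then show False using False by (rule notE[rotated])
      qed
      moreover have "\<forall>u\<in>B. c u = 0"
      proof (rule B(5)[THEN spec, THEN mp, THEN mp])
        show "\<forall>u\<in>B. c u \<in> L" using c(1) by blast
        show "(\<Sum>u\<in>B. c u * v u) = 0" using eq \<open>c m = 0\<close> by simp
      qed
      ultimately show ?thesis by blast
    qed
    have expand: "v j = (\<Sum>u\<in>insert m B. A' u j * v u)" if "j < Suc m" for j
    proof -
      have "(\<Sum>u\<in>B. A' u j * v u) = (if j = m then 0 else v j)"
      proof (cases "j = m")
        case True
        have "(\<Sum>u\<in>B. A' u j * v u) = 0"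
          using fB True by (intro sum.neutral) (auto simp: A'_def)
        then show ?thesis using True by simp
      next
        case False
        then have "(\<Sum>u\<in>B. A' u j * v u) = (\<Sum>u\<in>B. A u j * v u)"
          using fB by (intro sum.cong) (auto simp: A'_def)
        also have "\<dots> = v j" using False that by (intro B(4)[rule_format, symmetric]) simp
        finally show ?thesis using False by simp
      qed
      then show ?thesis using fB by (simp add: A'_def)
    qed
    show ?thesis
    proof (intro exI[of _ "insert m B"] exI[of _ A'] conjI allI impI)
      show "insert m B \<subseteq> {..<Suc m}" using B(1) by auto
      show "A' u j \<in> L" for u j using B(2) by (simp add: A'_def)
      show "\<forall>u\<in>insert m B. \<forall>j\<in>insert m B. A' u j = (if u = j then 1 else 0)"
        using B(3) fB(2) by (auto simp: A'_def)
    qed (fact expand, fact indep)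
  qed
qed

end

section \<open>Generalized Moore matrices\<close>

text \<open>The map \<open>c\<close> sorts the columns into classes, later the blocks of a codeword.
  Relations are tested inside a single class only, because columns of different classes are
  separated by norms instead.\<close>

definition classwise_independent ::
    "'a::field set \<Rightarrow> 'p set \<Rightarrow> ('p \<Rightarrow> 't) \<Rightarrow> ('p \<Rightarrow> 'a) \<Rightarrow> bool"
  where "classwise_independent K P c \<gamma> \<longleftrightarrow>
    (\<forall>x t. (\<forall>p\<in>P. x p \<in> K) \<longrightarrow> (\<Sum>p | p \<in> P \<and> c p = t. x p * \<gamma> p) = 0 \<longrightarrow>
      (\<forall>p\<in>P. c p = t \<longrightarrow> x p = 0))"

lemma classwise_independentD:
  assumes "classwise_independent K P c \<gamma>" "\<And>p. p \<in> P \<Longrightarrow> x p \<in> K"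
    and "(\<Sum>p | p \<in> P \<and> c p = t. x p * \<gamma> p) = 0" "p \<in> P" "c p = t"
  shows "x p = 0"
proof -
  have "\<forall>p\<in>P. c p = t \<longrightarrow> x p = 0"
    using assms(1)[unfolded classwise_independent_def, THEN spec[of _ x], THEN spec[of _ t]]
      assms(2,3) by simp
  then show ?thesis using assms(4,5) by simp
qed

lemma classwise_independent_cong:
  assumes "\<And>p. p \<in> P \<Longrightarrow> \<gamma> p = \<gamma>' p"
  shows "classwise_independent K P c \<gamma> = classwise_independent K P c \<gamma>'"
proof -
  have "(\<Sum>p | p \<in> P \<and> c p = t. x p * \<gamma> p) = (\<Sum>p | p \<in> P \<and> c p = t. x p * \<gamma>' p)"
    for x t using assms by (intro sum.cong) auto
  then show ?thesis by (simp add: classwise_independent_def)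
qed

lemma classwise_independent_subset:
  fixes K :: "'a::field set"
  assumes "classwise_independent K P c \<gamma>" "Q \<subseteq> P" "finite P" "0 \<in> K"
  shows "classwise_independent K Q c \<gamma>"
  unfolding classwise_independent_def
proof (intro allI impI ballI)
  fix x t p
  assume x: "\<forall>p\<in>Q. x p \<in> K" "(\<Sum>p | p \<in> Q \<and> c p = t. x p * \<gamma> p) = 0" "p \<in> Q" "c p = t"
  have "(\<Sum>p | p \<in> P \<and> c p = t. (if p \<in> Q then x p else 0) * \<gamma> p) =
      (\<Sum>p | p \<in> Q \<and> c p = t. x p * \<gamma> p)"
    using assms(2,3) by (intro sum.mono_neutral_cong_right) auto
  then have "(if p \<in> Q then x p else 0) = 0"
    using x assms(2,4) by (intro classwise_independentD[OF assms(1),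
        where x = "\<lambda>p. if p \<in> Q then x p else 0" and t = t and p = p]) auto
  then show "x p = 0" using x(3) by simp
qed

text \<open>All laws are relative to \<open>L\<close>, since the elements of
  \<open>galois_group\<close> are \<open>undefined\<close> outside their field.\<close>

locale subfield_endomorphism = ambient_subfield L for L :: "'a::field set" +
  fixes \<tau> :: "'a \<Rightarrow> 'a"
  assumes image_closed [simp]: "x \<in> L \<Longrightarrow> \<tau> x \<in> L"
    and hom_add: "x \<in> L \<Longrightarrow> y \<in> L \<Longrightarrow> \<tau> (x + y) = \<tau> x + \<tau> y"
    and hom_mult: "x \<in> L \<Longrightarrow> y \<in> L \<Longrightarrow> \<tau> (x * y) = \<tau> x * \<tau> y"
    and hom_one: "\<tau> 1 = 1"
begin

lemma hom_zero [simp]: "\<tau> 0 = 0"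
proof -
  have "\<tau> 0 + \<tau> 0 = \<tau> 0 + 0"
    using hom_add[of 0 0] by (simp only: closed(1) add_0_left add_0_right)
  then show ?thesis by (rule add_left_imp_eq)
qed

lemma eq_zero_iff [simp]: "x \<in> L \<Longrightarrow> \<tau> x = 0 \<longleftrightarrow> x = 0"
  using hom_mult[of x "inverse x"] hom_one by (cases "x = 0") auto

lemma hom_sum: "(\<And>i. i \<in> A \<Longrightarrow> f i \<in> L) \<Longrightarrow> \<tau> (sum f A) = (\<Sum>i\<in>A. \<tau> (f i))"
  by (induction A rule: infinite_finite_induct) (auto simp: hom_add)

lemma funpow_closed [simp]: "x \<in> L \<Longrightarrow> (\<tau> ^^ i) x \<in> L"
  by (induction i) auto

lemma iterate_add: "x \<in> L \<Longrightarrow> y \<in> L \<Longrightarrow> (\<tau> ^^ i) (x + y) = (\<tau> ^^ i) x + (\<tau> ^^ i) y"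
  by (induction i) (auto simp: hom_add)

lemma iterate_mult: "x \<in> L \<Longrightarrow> y \<in> L \<Longrightarrow> (\<tau> ^^ i) (x * y) = (\<tau> ^^ i) x * (\<tau> ^^ i) y"
  by (induction i) (auto simp: hom_mult)

lemma funpow_zero [simp]: "(\<tau> ^^ i) 0 = 0"
  by (induction i) auto

lemma funpow_one: "(\<tau> ^^ i) 1 = 1"
  by (induction i) (auto simp: hom_one)

lemma funpow_sum: "(\<And>j. j \<in> A \<Longrightarrow> f j \<in> L) \<Longrightarrow> (\<tau> ^^ i) (sum f A) = (\<Sum>j\<in>A. (\<tau> ^^ i) (f j))"
  by (induction A rule: infinite_finite_induct) (auto simp: iterate_add)

lemma funpow_eq_zero_iff [simp]: "x \<in> L \<Longrightarrow> (\<tau> ^^ i) x = 0 \<longleftrightarrow> x = 0"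
  by (induction i) auto

lemma hom_inverse: "x \<in> L \<Longrightarrow> \<tau> (inverse x) = inverse (\<tau> x)"
  using hom_mult[of x "inverse x"] hom_one
  by (cases "x = 0") (auto intro!: inverse_unique[symmetric])

lemma iterate_minus: "x \<in> L \<Longrightarrow> (\<tau> ^^ i) (- x) = - (\<tau> ^^ i) x"
  using iterate_add[of x "- x" i] by (simp add: eq_neg_iff_add_eq_0 add.commute)

lemma iterate_inverse: "x \<in> L \<Longrightarrow> (\<tau> ^^ i) (inverse x) = inverse ((\<tau> ^^ i) x)"
  by (induction i) (auto simp: hom_inverse)

end

text \<open>What the rank arguments take from cyclic Galois theory. It is instantiated for
  \<open>\<sigma>\<close> on \<open>L\<close> over \<open>K\<close>, for \<open>\<theta>\<close> on
  \<open>F\<close> over \<open>E\<close>, and for powers of \<open>\<sigma>\<close>.\<close>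

locale subfield_automorphism = subfield_endomorphism L \<tau>
  for L K :: "'a::field set" and \<tau> :: "'a \<Rightarrow> 'a" and m :: nat +
  assumes period: "x \<in> L \<Longrightarrow> (\<tau> ^^ m) x = x"
    and fixed: "{x \<in> L. \<tau> x = x} = K"
begin

lemma fixed_closed [simp]: "x \<in> K \<Longrightarrow> x \<in> L"
  and fixed_eq [simp]: "x \<in> K \<Longrightarrow> \<tau> x = x"
  and fixedI: "x \<in> L \<Longrightarrow> \<tau> x = x \<Longrightarrow> x \<in> K"
  using fixed by auto

lemma funpow_fixed [simp]: "x \<in> K \<Longrightarrow> (\<tau> ^^ i) x = x"
  by (induction i) auto

lemma fixed_0 [simp]: "0 \<in> K" and fixed_1 [simp]: "1 \<in> K"
  by (auto intro!: fixedI simp: hom_one)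

lemma fixed_mult [simp]: "x \<in> K \<Longrightarrow> y \<in> K \<Longrightarrow> x * y \<in> K"
  by (auto intro!: fixedI simp: hom_mult)

lemma fixed_divide [simp]: "x \<in> K \<Longrightarrow> y \<in> K \<Longrightarrow> x / y \<in> K"
  by (auto intro!: fixedI simp: hom_mult hom_inverse divide_inverse)

lemma fixed_power [simp]: "x \<in> K \<Longrightarrow> x ^ i \<in> K"
  by (induction i) auto

text \<open>On one class \<open>\<alpha>\<close> is a constant and \<open>\<tau>\<close> fixes the
  coefficients, so a relation among the new columns is a nonzero multiple of \<open>\<tau>\<close>
  applied to a relation among the old ones; \<open>\<tau>\<close> has trivial kernel. Iterating this
  step passes from one row of a Moore matrix to a later one.\<close>

lemma classwise_independent_image:
  assumes "classwise_independent K P c \<gamma>" "\<And>p. p \<in> P \<Longrightarrow> \<gamma> p \<in> L"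
    and "\<And>p. p \<in> P \<Longrightarrow> \<alpha> (c p) \<in> K - {0}"
  shows "classwise_independent K P c (\<lambda>p. \<alpha> (c p) * \<tau> (\<gamma> p))"
  unfolding classwise_independent_def
proof (intro allI impI ballI)
  fix x t p
  assume x: "\<forall>p\<in>P. x p \<in> K"
    "(\<Sum>p | p \<in> P \<and> c p = t. x p * (\<alpha> (c p) * \<tau> (\<gamma> p))) = 0" "p \<in> P" "c p = t"
  have "\<tau> (\<Sum>p | p \<in> P \<and> c p = t. x p * \<gamma> p) = (\<Sum>p | p \<in> P \<and> c p = t. x p * \<tau> (\<gamma> p))"
    using x(1) assms(2) by (subst hom_sum) (auto simp: hom_mult)
  moreover have "\<alpha> t * (\<Sum>p | p \<in> P \<and> c p = t. x p * \<tau> (\<gamma> p)) = 0"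
    unfolding x(2)[symmetric] sum_distrib_left by (intro sum.cong) auto
  ultimately have "\<tau> (\<Sum>p | p \<in> P \<and> c p = t. x p * \<gamma> p) = 0"
    using assms(3)[OF x(3)] x(4) by simp
  moreover have "(\<Sum>p | p \<in> P \<and> c p = t. x p * \<gamma> p) \<in> L"
    using x(1) assms(2) by (intro sum_closed) auto
  ultimately have "(\<Sum>p | p \<in> P \<and> c p = t. x p * \<gamma> p) = 0" by simp
  then show "x p = 0"
    using x by (intro classwise_independentD[OF assms(1), where x = x and t = t and p = p]) auto
qed

lemma classwise_independent_funpow:
  assumes "classwise_independent K P c \<gamma>" "\<And>p. p \<in> P \<Longrightarrow> \<gamma> p \<in> L"
    and "\<And>p. p \<in> P \<Longrightarrow> \<alpha> (c p) \<in> K - {0}"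
  shows "classwise_independent K P c (\<lambda>p. \<alpha> (c p) ^ i * (\<tau> ^^ i) (\<gamma> p))"
proof (induction i)
  case 0
  show ?case using assms(1) by simp
next
  case (Suc i)
  have "classwise_independent K P c (\<lambda>p. \<alpha> (c p) * \<tau> (\<alpha> (c p) ^ i * (\<tau> ^^ i) (\<gamma> p)))"
    using assms by (intro classwise_independent_image Suc) auto
  also have "classwise_independent K P c (\<lambda>p. \<alpha> (c p) * \<tau> (\<alpha> (c p) ^ i * (\<tau> ^^ i) (\<gamma> p))) =
      classwise_independent K P c (\<lambda>p. \<alpha> (c p) ^ Suc i * (\<tau> ^^ Suc i) (\<gamma> p))"
  proof (rule classwise_independent_cong)
    fix p assume p: "p \<in> P"
    have "\<tau> (\<alpha> (c p) ^ i * (\<tau> ^^ i) (\<gamma> p)) = \<alpha> (c p) ^ i * \<tau> ((\<tau> ^^ i) (\<gamma> p))"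
      using assms(2,3)[OF p] by (simp add: hom_mult)
    then show "\<alpha> (c p) * \<tau> (\<alpha> (c p) ^ i * (\<tau> ^^ i) (\<gamma> p)) =
      \<alpha> (c p) ^ Suc i * (\<tau> ^^ Suc i) (\<gamma> p)"
      by (simp add: mult.assoc)
  qed
  finally show ?case .
qed

text \<open>Applying \<open>\<tau>\<close> to a relation normalised at
  \<open>p0\<close> and comparing it with the original one eliminates the column \<open>p0\<close>. The induction hypothesis
  then gives \<open>\<tau>(y p) = (\<alpha> p / \<alpha> p0) y p\<close>, and iterating this \<open>m\<close> times forces \<open>y p = 0\<close> outside
  the class of \<open>p0\<close> because the norms \<open>\<alpha> ^ m\<close> separate the classes.\<close>

lemma moore_columns_independent:
  assumes "finite P" "classwise_independent K P c \<gamma>"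
    and "\<And>p. p \<in> P \<Longrightarrow> \<gamma> p \<in> L" "\<And>p. p \<in> P \<Longrightarrow> \<alpha> (c p) \<in> K - {0}"
    and "\<And>p q. p \<in> P \<Longrightarrow> q \<in> P \<Longrightarrow> \<alpha> (c p) ^ m = \<alpha> (c q) ^ m \<Longrightarrow> c p = c q"
    and "\<And>p. p \<in> P \<Longrightarrow> y p \<in> L" "card P \<le> N"
    and "\<And>i. i < N \<Longrightarrow> (\<Sum>p\<in>P. y p * (\<alpha> (c p) ^ i * (\<tau> ^^ i) (\<gamma> p))) = 0"
  shows "\<forall>p\<in>P. y p = 0"
  using assms
proof (induction P arbitrary: \<gamma> y N rule: finite_psubset_induct)
  case (psubset P)
  note ind = psubset.prems(1) and \<gamma>L = psubset.prems(2) and \<alpha>K = psubset.prems(3)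
    and norms = psubset.prems(4) and yL = psubset.prems(5) and N = psubset.prems(6)
    and eq = psubset.prems(7)
  show ?case
  proof (rule ccontr)
    assume "\<not> (\<forall>p\<in>P. y p = 0)"
    then obtain p0 where p0: "p0 \<in> P" "y p0 \<noteq> 0" by auto
    define w where "w p = y p / y p0" for p
    have wL: "w p \<in> L" if "p \<in> P" for p using yL that p0 by (simp add: w_def)
    have w0: "w p0 = 1" using p0 by (simp add: w_def)
    have weq: "(\<Sum>p\<in>P. w p * (\<alpha> (c p) ^ i * (\<tau> ^^ i) (\<gamma> p))) = 0" if "i < N" for i
    proof -
      have "(\<Sum>p\<in>P. w p * (\<alpha> (c p) ^ i * (\<tau> ^^ i) (\<gamma> p))) =
          (\<Sum>p\<in>P. y p * (\<alpha> (c p) ^ i * (\<tau> ^^ i) (\<gamma> p))) / y p0"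
        by (simp add: w_def sum_divide_distrib)
      then show ?thesis using eq[OF that] by simp
    qed
    have N1: "0 < card P" using psubset.hyps p0(1) card_gt_0_iff by blast
    \<comment> \<open>Applying \<open>\<tau>\<close> to the relation of row \<open>i\<close> and
      subtracting the relation of row \<open>i + 1\<close> divided by \<open>\<alpha> (c p0)\<close>
      leaves these coefficients for row \<open>i\<close> of the matrix of
      \<open>\<alpha> (c p) * \<tau> (\<gamma> p)\<close>. They vanish at \<open>p0\<close> because
      \<open>w p0 = 1\<close>. One row is used up, hence \<open>N - 1\<close>.\<close>
    define z where "z p = \<tau> (w p) / \<alpha> (c p) - w p / \<alpha> (c p0)" for p
    have z0: "z p0 = 0" by (simp add: z_def w0 hom_one)
    have "\<forall>p\<in>P - {p0}. z p = 0"
    proof (rule psubset.IH)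
      show "P - {p0} \<subset> P" using p0(1) by auto
      show "classwise_independent K (P - {p0}) c (\<lambda>p. \<alpha> (c p) * \<tau> (\<gamma> p))"
        by (rule classwise_independent_subset[OF classwise_independent_image[OF ind]])
          (use \<gamma>L \<alpha>K psubset.hyps in auto)
      show "card (P - {p0}) \<le> N - 1" using N p0(1) by simp
      show "(\<Sum>p\<in>P - {p0}. z p * (\<alpha> (c p) ^ i * (\<tau> ^^ i) (\<alpha> (c p) * \<tau> (\<gamma> p)))) = 0"
        if "i < N - 1" for i
      proof -
        have "(\<Sum>p\<in>P - {p0}. z p * (\<alpha> (c p) ^ i * (\<tau> ^^ i) (\<alpha> (c p) * \<tau> (\<gamma> p)))) =
            (\<Sum>p\<in>P. z p * (\<alpha> (c p) ^ i * (\<tau> ^^ i) (\<alpha> (c p) * \<tau> (\<gamma> p))))"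
          using p0(1) psubset.hyps z0 by (intro sum.mono_neutral_left) auto
        also have "\<dots> = (\<Sum>p\<in>P. \<tau> (w p * (\<alpha> (c p) ^ i * (\<tau> ^^ i) (\<gamma> p))) -
            w p * (\<alpha> (c p) ^ Suc i * (\<tau> ^^ Suc i) (\<gamma> p)) / \<alpha> (c p0))"
        proof (intro sum.cong refl)
          fix p assume p: "p \<in> P"
          have "(\<tau> ^^ i) (\<alpha> (c p) * \<tau> (\<gamma> p)) = \<alpha> (c p) * \<tau> ((\<tau> ^^ i) (\<gamma> p))"
            using \<alpha>K[OF p] \<gamma>L[OF p] by (simp add: iterate_mult funpow_swap1)
          moreover have "\<tau> (w p * (\<alpha> (c p) ^ i * (\<tau> ^^ i) (\<gamma> p))) =
              \<tau> (w p) * (\<alpha> (c p) ^ i * \<tau> ((\<tau> ^^ i) (\<gamma> p)))"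
            using \<alpha>K[OF p] \<gamma>L[OF p] wL[OF p] by (simp add: hom_mult)
          ultimately show "z p * (\<alpha> (c p) ^ i * (\<tau> ^^ i) (\<alpha> (c p) * \<tau> (\<gamma> p))) =
              \<tau> (w p * (\<alpha> (c p) ^ i * (\<tau> ^^ i) (\<gamma> p))) -
              w p * (\<alpha> (c p) ^ Suc i * (\<tau> ^^ Suc i) (\<gamma> p)) / \<alpha> (c p0)"
            using \<alpha>K[OF p] \<alpha>K[OF p0(1)] by (simp add: z_def field_simps)
        qed
        also have "\<dots> = \<tau> (\<Sum>p\<in>P. w p * (\<alpha> (c p) ^ i * (\<tau> ^^ i) (\<gamma> p))) -
            (\<Sum>p\<in>P. w p * (\<alpha> (c p) ^ Suc i * (\<tau> ^^ Suc i) (\<gamma> p))) / \<alpha> (c p0)"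
          unfolding sum_subtractf sum_divide_distrib using wL \<alpha>K \<gamma>L by (subst hom_sum) auto
        also have "\<dots> = 0" using weq[of i] weq[of "Suc i"] that by simp
        finally show ?thesis .
      qed
    qed (use \<alpha>K \<gamma>L norms wL p0(1) in \<open>auto simp: z_def\<close>)
    then have z: "\<tau> (w p) = \<alpha> (c p) / \<alpha> (c p0) * w p" if "p \<in> P" for p
    proof -
      have "z p = 0" using that z0 \<open>\<forall>p\<in>P - {p0}. z p = 0\<close> by (cases "p = p0") auto
      then have "\<tau> (w p) / \<alpha> (c p) = w p / \<alpha> (c p0)" by (simp add: z_def)
      then have "\<tau> (w p) = w p / \<alpha> (c p0) * \<alpha> (c p)"
        using \<alpha>K[OF that] by (simp only: divide_eq_eq) simp
      then show ?thesis by simp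
    qed
    have other: "w p = 0" if p: "p \<in> P" "c p \<noteq> c p0" for p
    proof -
      have r: "\<alpha> (c p) / \<alpha> (c p0) \<in> K" using \<alpha>K[OF p(1)] \<alpha>K[OF p0(1)] by auto
      have "(\<tau> ^^ j) (w p) = (\<alpha> (c p) / \<alpha> (c p0)) ^ j * w p" for j
      proof (induction j)
        case (Suc j)
        have "\<tau> ((\<alpha> (c p) / \<alpha> (c p0)) ^ j * w p) = (\<alpha> (c p) / \<alpha> (c p0)) ^ j * \<tau> (w p)"
          using fixed_power[OF r, of j] wL[OF p(1)]
          by (simp only: hom_mult fixed_eq fixed_closed)
        then show ?case using Suc z[OF p(1)] by simp
      qed auto
      then have "(\<alpha> (c p) / \<alpha> (c p0)) ^ m * w p = w p" using period[OF wL[OF p(1)]] by metis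
      moreover have "(\<alpha> (c p) / \<alpha> (c p0)) ^ m \<noteq> 1"
        using norms[OF p(1) p0(1)] p(2) \<alpha>K[OF p0(1)] by (auto simp: power_divide)
      ultimately show ?thesis by simp
    qed
    \<comment> \<open>In the class of \<open>p0\<close> the ratio of the scalars is 1, so
      \<open>w p\<close> is a fixed point; outside it is 0. Row 0 thereby becomes a relation over
      \<open>K\<close> inside one class, with coefficient 1 at \<open>p0\<close>.\<close>
    have same: "w p \<in> K" if "p \<in> P" for p
      using z[OF that] other[OF that] wL[OF that] \<alpha>K[OF that] by (cases "c p = c p0") (auto intro: fixedI)
    have "(\<Sum>p | p \<in> P \<and> c p = c p0. w p * \<gamma> p) = (\<Sum>p\<in>P. w p * \<gamma> p)"
      using psubset.hyps other by (intro sum.mono_neutral_left) auto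
    also have "\<dots> = 0" using weq[of 0] N N1 by simp
    finally have "w p0 = 0"
      using same p0(1) by (intro classwise_independentD[OF ind, where x = w and t = "c p0" and p = p0]) auto
    then show False using w0 by simp
  qed
qed

text \<open>Restricting to \<open>N\<close> columns gives a square matrix with independent columns.
  If row \<open>i0\<close> depended on the other rows, a nonzero vector killed by those
  \<open>N - 1\<close> rows would be killed by row \<open>i0\<close> as well.\<close>

lemma moore_rows_independent:
  assumes "finite P" "classwise_independent K P c \<gamma>"
    and "\<And>p. p \<in> P \<Longrightarrow> \<gamma> p \<in> L" "\<And>p. p \<in> P \<Longrightarrow> \<alpha> (c p) \<in> K - {0}"
    and "\<And>p q. p \<in> P \<Longrightarrow> q \<in> P \<Longrightarrow> \<alpha> (c p) ^ m = \<alpha> (c q) ^ m \<Longrightarrow> c p = c q"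
    and "\<And>i. i < N \<Longrightarrow> x i \<in> L" "N \<le> card P"
    and "\<And>p. p \<in> P \<Longrightarrow> (\<Sum>i<N. x i * (\<alpha> (c p) ^ i * (\<tau> ^^ i) (\<gamma> p))) = 0"
  shows "\<forall>i<N. x i = 0"
proof (rule ccontr)
  assume "\<not> (\<forall>i<N. x i = 0)"
  then obtain i0 where i0: "i0 < N" "x i0 \<noteq> 0" by auto
  obtain Q where Q: "Q \<subseteq> P" "card Q = N" "finite Q"
    using obtain_subset_with_card_n[OF assms(7)] by auto
  define M where "M i p = \<alpha> (c p) ^ i * (\<tau> ^^ i) (\<gamma> p)" for i p
  have M_closed: "M i p \<in> L" if "p \<in> Q" for i p using assms(3,4) Q(1) that by (auto simp: M_def)
  obtain y where y: "\<And>p. p \<in> Q \<Longrightarrow> y p \<in> L" "\<exists>p\<in>Q. y p \<noteq> 0"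
    "\<And>i. i \<in> {..<N} - {i0} \<Longrightarrow> (\<Sum>p\<in>Q. M i p * y p) = 0"
    by (rule homogeneous_system_solution[of "{..<N} - {i0}" Q M]) (use Q i0 M_closed in auto)
  \<comment> \<open>The bilinear expression in \<open>x\<close> and \<open>y\<close> vanishes when
    summed along rows first; summed along columns first it reduces to the contribution of row
    \<open>i0\<close>.\<close>
  have "0 = (\<Sum>p\<in>Q. y p * (\<Sum>i<N. x i * M i p))"
    using assms(8) Q(1) unfolding M_def by (intro sum.neutral[symmetric]) auto
  also have "\<dots> = (\<Sum>i<N. \<Sum>p\<in>Q. x i * (M i p * y p))"
    unfolding sum_distrib_left by (subst sum.swap) (simp add: mult_ac)
  also have "\<dots> = (\<Sum>i<N. x i * (\<Sum>p\<in>Q. M i p * y p))"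
    by (simp add: sum_distrib_left)
  also have "\<dots> = x i0 * (\<Sum>p\<in>Q. M i0 p * y p)"
    using i0(1) y(3) by (subst sum.remove[of _ i0]) auto
  finally have "(\<Sum>p\<in>Q. M i p * y p) = 0" if "i < N" for i
    using i0 y(3)[of i] that by (cases "i = i0") auto
  then have "\<forall>p\<in>Q. y p = 0"
    using Q assms(3,4,5) y(1) classwise_independent_subset[OF assms(2) Q(1) assms(1)]
    by (intro moore_columns_independent[of Q c \<gamma> \<alpha> y N]) (auto simp: M_def mult.commute subset_iff)
  then show False using y(2) by blast
qed

end

section \<open>The Roos argument\<close>

lemma classwise_independent_nonzero:
  fixes K :: "'a::field set"
  assumes "classwise_independent K P c \<gamma>" "finite P" "p \<in> P" "0 \<in> K" "1 \<in> K"
  shows "\<gamma> p \<noteq> 0"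
proof
  assume "\<gamma> p = 0"
  then have "(\<Sum>q | q \<in> P \<and> c q = c p. (if q = p then 1 else 0) * \<gamma> q) = 0"
    by (intro sum.neutral) auto
  then have "(if p = p then 1 else 0) = (0::'a)"
    using assms(3-5) by (intro classwise_independentD[OF assms(1),
      where x = "\<lambda>q. if q = p then 1 else 0" and t = "c p" and p = p]) auto
  then show False by simp
qed

text \<open>The order of \<open>a\<close> is exactly \<open>l\<close>, and \<open>u\<close> is
  invertible modulo \<open>l\<close>. With \<open>u = m\<close> and \<open>u = s * m\<close> this is
  the separation of norms for the two Moore matrices.\<close>

lemma primitive_root_power_inj:
  fixes a :: "'a::field"
  assumes "primitive_root_of_unity l a" "coprime u l" "t < l" "t' < l" "a ^ (t * u) = a ^ (t' * u)"
  shows "t = t'"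
proof -
  have a: "a ^ l = 1" "\<And>k. 0 < k \<Longrightarrow> k < l \<Longrightarrow> a ^ k \<noteq> 1"
    using assms(1) by (auto simp: primitive_root_of_unity_def)
  have a0: "a \<noteq> 0" using a(1) assms(3) by (auto simp: zero_power)
  have main: "t = t'" if "t \<le> t'" "t' < l" "a ^ (t * u) = a ^ (t' * u)" for t t'
  proof (rule ccontr)
    assume "t \<noteq> t'"
    define e where "e = (t' - t) * u"
    have "a ^ (t' * u) = a ^ (t * u) * a ^ e"
      using that(1) by (simp add: e_def power_add[symmetric] add_mult_distrib[symmetric])
    then have "a ^ e = 1" using that(3) a0 by simp
    moreover have "a ^ e = a ^ (e mod l)"
    proof -
      have "a ^ e = a ^ (l * (e div l) + e mod l)" by simp
      also have "\<dots> = a ^ (e mod l)" by (simp only: power_add power_mult a(1)) simp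
      finally show ?thesis .
    qed
    moreover have "e mod l < l" using that(2) by simp
    ultimately have "e mod l = 0" using a(2)[of "e mod l"] by (cases "e mod l = 0") auto
    then have "l dvd (t' - t) * u" by (auto simp: e_def)
    then have "l dvd t' - t"
      using assms(2) by (simp add: coprime_dvd_mult_left_iff coprime_commute)
    then show False using that \<open>t \<noteq> t'\<close> by (auto dest!: dvd_imp_le)
  qed
  show ?thesis using main[of t t'] main[of t' t] assms(3-5) by (cases "t \<le> t'") auto
qed

context subfield_automorphism
begin

lemma funpow_period: "x \<in> L \<Longrightarrow> (\<tau> ^^ (m * i)) x = x"
proof (induction i)
  case (Suc i)
  then show ?case using period by (simp add: funpow_add)
qed auto

text \<open>The fixed field cannot grow: by Bezout some \<open>u * j + 1\<close> is a multiple of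
  \<open>m\<close>, so a point fixed by \<open>\<tau> ^^ u\<close> satisfies
  \<open>\<tau> x = (\<tau> ^^ (m * i)) x = x\<close>.\<close>

lemma automorphism_funpow:
  assumes "coprime u m" "m > 0"
  shows "subfield_automorphism L K (\<tau> ^^ u) m"
proof unfold_locales
  show "((\<tau> ^^ u) ^^ m) x = x" if "x \<in> L" for x
    using funpow_period[OF that, of u] by (simp add: funpow_mult mult.commute)
  obtain i j where "m * i = u * j + gcd m u" using bezout_nat[of m u] assms(2) by auto
  then have ij: "m * i = Suc (u * j)" using assms(1) by (simp add: coprime_commute)
  have "x \<in> K" if x: "x \<in> L" "(\<tau> ^^ u) x = x" for x
  proof -
    have "(\<tau> ^^ (u * j)) x = x"
    proof (induction j)
      case (Suc j)
      then show ?case using x(2) by (simp add: funpow_add)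
    qed auto
    then have "\<tau> x = (\<tau> ^^ (m * i)) x" unfolding ij by simp
    then show ?thesis using funpow_period[OF x(1)] by (intro fixedI[OF x(1)]) simp
  qed
  then show "{x \<in> L. (\<tau> ^^ u) x = x} = K" by auto
qed (auto simp: iterate_add iterate_mult funpow_one)

text \<open>Applying \<open>\<tau> ^^ (- s * i)\<close> to the \<open>(i, j)\<close>-th hypothesis makes it say that
  the \<open>i\<close>-th row of the Moore matrix of \<open>Y\<close> (for \<open>\<tau> ^^ (- s)\<close>) is orthogonal to the row
  \<open>V (k j)\<close> of the Moore matrix of \<open>\<gamma>\<close>. If \<open>card P < d + r\<close>, some nontrivial combination
  of the \<open>d - 1\<close> rows for \<open>Y\<close> is also orthogonal to the \<open>d - 2\<close> rows \<open>V e\<close>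
  with \<open>k 0 \<le> e < k 0 + d + r - 1\<close> that are not of the form \<open>V (k j)\<close>, and hence vanishes.\<close>

lemma roos_argument:
  fixes c :: "'p \<Rightarrow> nat" and k :: "nat \<Rightarrow> nat"
  assumes "finite P" "P \<noteq> {}" "\<And>p. p \<in> P \<Longrightarrow> c p < l"
    and "classwise_independent K P c \<gamma>" "\<And>p. p \<in> P \<Longrightarrow> \<gamma> p \<in> L"
    and "classwise_independent K P c Y" "\<And>p. p \<in> P \<Longrightarrow> Y p \<in> L"
    and "a \<in> K" "primitive_root_of_unity l a"
    and "m > 0" "coprime s m" "coprime s l" "coprime m l"
    and "\<And>i j. i < j \<Longrightarrow> j \<le> r \<Longrightarrow> k i < k j" "k r + 2 \<le> k 0 + d + r"
    and "\<And>i j. i < d - 1 \<Longrightarrow> j \<le> r \<Longrightarrow>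
      (\<Sum>p\<in>P. Y p * (a ^ (c p * (s * i + k j)) * (\<tau> ^^ (s * i + k j)) (\<gamma> p))) = 0"
  shows "d + r \<le> card P"
proof (rule ccontr)
  assume "\<not> d + r \<le> card P"
  have l0: "l > 0" using assms(2,3) by fastforce
  have a0: "a \<noteq> 0" using assms(9) l0 by (auto simp: primitive_root_of_unity_def zero_power)
  have kmono: "k 0 \<le> k j" "k j \<le> k r" if "j \<le> r" for j
    using assms(14)[of 0 j] assms(14)[of j r] that by (cases "j = 0"; cases "j = r"; simp)+
  have kr: "k 0 + r \<le> k r"
  proof -
    have "k 0 + j \<le> k j" if "j \<le> r" for j
      using that
    proof (induction j)
      case (Suc j)
      then show ?case using assms(14)[of j "Suc j"] by simp
    qed auto
    then show ?thesis by simp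
  qed
  \<comment> \<open>Strictly increasing exponents spread over at least \<open>r\<close>, so the
    window condition forces this bound, and the natural subtractions \<open>d - 1\<close> and
    \<open>d + r - 1\<close> are honest.\<close>
  then have d2: "d \<ge> 2" using assms(15) by simp
  define N where "N = d + r - 1"
  have PN: "card P \<le> N" using \<open>\<not> d + r \<le> card P\<close> by (simp add: N_def)
  \<comment> \<open>A natural number congruent to \<open>- s\<close> modulo \<open>m\<close>:
    \<open>u + s = m * s\<close>.\<close>
  define u where "u = (m - 1) * s"
  have "coprime (m - 1) m" using coprime_diff_one_left_nat[of m] assms(10) by simp
  then have "coprime u m" using assms(11) by (simp add: u_def)
  then interpret T: subfield_automorphism L K "\<tau> ^^ u" m
    using assms(10) by (intro automorphism_funpow)
  define V where "V e p = a ^ (c p * e) * (\<tau> ^^ e) (\<gamma> p)" for e p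
  \<comment> \<open>Row \<open>i\<close> for \<open>Y\<close>. It also takes over the scalar
    \<open>a ^ (c p * (s * i))\<close>, which \<open>\<tau>\<close> fixes, so that only the exponent
    \<open>k j\<close> remains in \<open>V\<close>.\<close>
  define y where "y i p = (a ^ (s * c p)) ^ i * ((\<tau> ^^ u) ^^ i) (Y p)" for i p
  have VL: "V e p \<in> L" if "p \<in> P" for e p using assms(5,8) that by (simp add: V_def)
  have yL: "y i p \<in> L" if "p \<in> P" for i p using assms(7,8) that by (simp add: y_def)
  have apow: "a ^ i \<in> K - {0}" for i using assms(8) a0 by simp
  have normY: "c p = c q"
    if "p \<in> P" "q \<in> P" "(a ^ (s * c p)) ^ m = (a ^ (s * c q)) ^ m" for p q
    using that assms(3,9,12,13)
    by (intro primitive_root_power_inj[of l a "s * m"]) (simp_all add: power_mult[symmetric] mult_ac)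
  have norm\<gamma>: "c p = c q" if "p \<in> P" "q \<in> P" "(a ^ c p) ^ m = (a ^ c q) ^ m" for p q
    using that assms(3,9,12,13)
    by (intro primitive_root_power_inj[of l a m]) (simp_all add: power_mult[symmetric] mult_ac)
  have orth: "(\<Sum>p\<in>P. y i p * V (k j) p) = 0" if "i < d - 1" "j \<le> r" for i j
  proof -
    have "(\<Sum>p\<in>P. y i p * V (k j) p) = (\<tau> ^^ (u * i))
        (\<Sum>p\<in>P. Y p * (a ^ (c p * (s * i + k j)) * (\<tau> ^^ (s * i + k j)) (\<gamma> p)))"
    proof (subst funpow_sum, goal_cases)
      case 2
      show ?case
      proof (intro sum.cong refl)
        fix p assume p: "p \<in> P"
        have "u * i + s * i = m * (s * i)"
          using assms(10) by (cases m) (auto simp: u_def algebra_simps)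
        then have "(\<tau> ^^ (u * i)) ((\<tau> ^^ (s * i + k j)) (\<gamma> p)) =
            (\<tau> ^^ (m * (s * i))) ((\<tau> ^^ k j) (\<gamma> p))"
          by (metis (no_types, lifting) funpow_add add.assoc comp_apply)
        then have "(\<tau> ^^ (u * i)) ((\<tau> ^^ (s * i + k j)) (\<gamma> p)) = (\<tau> ^^ k j) (\<gamma> p)"
          using p assms(5) by (simp add: funpow_period)
        then show "y i p * V (k j) p = (\<tau> ^^ (u * i))
            (Y p * (a ^ (c p * (s * i + k j)) * (\<tau> ^^ (s * i + k j)) (\<gamma> p)))"
          using p assms(5,7,8)
          by (simp add: iterate_mult y_def V_def funpow_mult mult.commute[of u]
              power_mult[symmetric] power_add algebra_simps)
      qed
    qed (use assms(5,7,8) in auto)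
    then show ?thesis using assms(16)[OF that] by simp
  qed
  \<comment> \<open>With at most \<open>d - 1\<close> columns the rows \<open>y i\<close> have full
    column rank and already kill \<open>V (k 0)\<close>, whose entries are nonzero. Otherwise these
    rows are independent among themselves, and the gaps between the \<open>k j\<close> have to be
    filled.\<close>
  show False
  proof (cases "card P \<le> d - 1")
    case True
    have "\<forall>p\<in>P. V (k 0) p = 0"
    proof (rule T.moore_columns_independent[of P c Y "\<lambda>t. a ^ (s * t)" "V (k 0)" "d - 1"])
      show "(\<Sum>p\<in>P. V (k 0) p * ((a ^ (s * c p)) ^ i * ((\<tau> ^^ u) ^^ i) (Y p))) = 0"
        if "i < d - 1" for i
        using orth[OF that, of 0] by (simp add: y_def mult.commute)
    qed (use assms(1,6,7) apow VL normY True in auto)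
    moreover obtain p where "p \<in> P" using assms(2) by auto
    moreover have "\<gamma> p \<noteq> 0"
      using classwise_independent_nonzero[OF assms(4,1) \<open>p \<in> P\<close>] by simp
    ultimately show False using a0 assms(5) by (auto simp: V_def)
  next
    case False
    \<comment> \<open>The offsets of the given exponents inside the window of \<open>N\<close>
      consecutive exponents starting at \<open>k 0\<close>. Its complement has
      \<open>N - (r + 1) = d - 2\<close> elements, one fewer than the available rows
      \<open>y i\<close>.\<close>
    define J where "J = (\<lambda>j. k j - k 0) ` {..r}"
    have "inj_on (\<lambda>j. k j - k 0) {..r}"
    proof (rule linorder_inj_onI)
      fix i j assume ij: "i < j" "i \<in> {..r}" "j \<in> {..r}"
      then show "k i - k 0 \<noteq> k j - k 0" using assms(14)[of i j] kmono(1)[of i] by simp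
    qed auto
    then have cardJ: "card J = Suc r" by (simp add: J_def card_image)
    have JN: "J \<subseteq> {..<N}"
    proof
      fix e assume "e \<in> J"
      then obtain j where "j \<le> r" "e = k j - k 0" by (auto simp: J_def)
      then show "e \<in> {..<N}" using kmono[of j] assms(15) d2 by (simp add: N_def)
    qed
    then have "card ({..<N} - J) = N - Suc r"
      using cardJ by (simp add: card_Diff_subset finite_subset)
    then have "card ({..<N} - J) < card {..<d - 1}" using d2 by (simp add: N_def)
    then obtain q where q: "\<And>i. i \<in> {..<d - 1} \<Longrightarrow> q i \<in> L" "\<exists>i\<in>{..<d - 1}. q i \<noteq> 0"
      "\<And>e. e \<in> {..<N} - J \<Longrightarrow> (\<Sum>i<d - 1. (\<Sum>p\<in>P. y i p * V (k 0 + e) p) * q i) = 0"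
      by (rule homogeneous_system_solution[of "{..<N} - J" "{..<d - 1}"
            "\<lambda>e i. \<Sum>p\<in>P. y i p * V (k 0 + e) p", rotated 2])
        (use VL yL in auto)
    define z where "z p = (\<Sum>i<d - 1. q i * y i p)" for p
    have zV: "(\<Sum>p\<in>P. z p * V (k 0 + e) p) = 0" if "e < N" for e
    proof -
      have "(\<Sum>p\<in>P. z p * V (k 0 + e) p) = (\<Sum>i<d - 1. (\<Sum>p\<in>P. y i p * V (k 0 + e) p) * q i)"
        unfolding z_def sum_distrib_right by (subst sum.swap) (simp add: mult_ac)
      also have "\<dots> = 0"
      proof (cases "e \<in> J")
        case True
        then obtain j where "j \<le> r" "k 0 + e = k j" using kmono(1) by (auto simp: J_def)
        then show ?thesis using orth by simp
      next
        case False
        then show ?thesis using q(3) that by simp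
      qed
      finally show ?thesis .
    qed
    \<comment> \<open>\<open>z\<close> is orthogonal to a full window of \<open>N\<close>
      consecutive rows. Taking \<open>V (k 0)\<close> in place of \<open>\<gamma>\<close> moves the
      start of the window to row 0.\<close>
    have "\<forall>p\<in>P. z p = 0"
    proof (rule moore_columns_independent[of P c "V (k 0)" "\<lambda>t. a ^ t" z N])
      show "classwise_independent K P c (V (k 0))"
        using classwise_independent_funpow[OF assms(4), of "\<lambda>t. a ^ t" "k 0"] assms(5) apow
        by (simp add: V_def[abs_def] power_mult)
      show "(\<Sum>p\<in>P. z p * ((a ^ c p) ^ i * (\<tau> ^^ i) (V (k 0) p))) = 0" if "i < N" for i
      proof -
        have "(a ^ c p) ^ i * (\<tau> ^^ i) (V (k 0) p) = V (k 0 + i) p" if "p \<in> P" for p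
          using assms(5)[OF that] assms(8)
          by (simp add: V_def iterate_mult power_mult[symmetric] power_add algebra_simps
              funpow_add)
        then show ?thesis using zV[OF that] by simp
      qed
    qed (use assms(1) apow VL norm\<gamma> PN q(1) yL in \<open>auto simp: z_def\<close>)
    \<comment> \<open>Here \<open>z\<close> is a vanishing combination of the \<open>d - 1\<close>
      rows of \<open>Y\<close>, with at least \<open>d - 1\<close> columns at hand.\<close>
    then have "\<forall>i<d - 1. q i = 0"
      using False assms(1,6,7) apow normY q(1)
      by (intro T.moore_rows_independent[of P c Y "\<lambda>t. a ^ (s * t)"])
        (auto simp: z_def y_def)
    then show False using q(2) by auto
  qed
qed

end

section \<open>Skew polynomial rings\<close>

text \<open>Both sides run over the pairs with \<open>j + i \<le> N\<close>; this exchange is the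
  core of associativity of the skew product.\<close>

lemma (in abelian_monoid) finsum_triangle:
  assumes "\<And>i j. f i j \<in> carrier G"
  shows "(\<Oplus>n\<in>{..N::nat}. \<Oplus>j\<in>{..n}. f j (n - j)) = (\<Oplus>j\<in>{..N}. \<Oplus>i\<in>{..N - j}. f j i)"
proof (induction N)
  case 0
  show ?case using assms by simp
next
  case (Suc N)
  have "(\<Oplus>j\<in>{..N}. \<Oplus>i\<in>{..Suc N - j}. f j i) =
      (\<Oplus>j\<in>{..N}. f j (Suc N - j) \<oplus> (\<Oplus>i\<in>{..N - j}. f j i))"
    using assms by (intro finsum_cong) (auto simp: Suc_diff_le simp_implies_def)
  also have "\<dots> = (\<Oplus>j\<in>{..N}. f j (Suc N - j)) \<oplus> (\<Oplus>j\<in>{..N}. \<Oplus>i\<in>{..N - j}. f j i)"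
    using assms by (intro finsum_addf) auto
  finally show ?case using assms Suc by (simp add: a_ac Pi_def)
qed

locale skew_coefficients = ring A for A :: "('b, 'c) ring_scheme" (structure) +
  fixes \<tau> :: "'b \<Rightarrow> 'b"
  assumes endo: "\<tau> \<in> Ring.ring_hom A A"
begin

abbreviation "P \<equiv> skew_poly_ring A \<tau>"

lemma pow_hom: "(\<tau> ^^ i) \<in> Ring.ring_hom A A"
proof (induction i)
  case 0
  show ?case by (rule ring_hom_memI) auto
next
  case (Suc i)
  show ?case using ring_hom_trans[OF Suc endo] by (simp add: comp_def)
qed

lemma pow_closed [simp, intro]: "x \<in> carrier A \<Longrightarrow> (\<tau> ^^ i) x \<in> carrier A"
  using ring_hom_closed[OF pow_hom] .

lemmas pow_add = ring_hom_add[OF pow_hom]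
lemmas pow_mult = ring_hom_mult[OF pow_hom]
lemmas pow_one [simp] = ring_hom_one[OF pow_hom]

lemma pow_zero [simp]: "(\<tau> ^^ i) \<zero> = \<zero>"
  using ring_hom_zero[OF pow_hom ring_axioms ring_axioms] .

lemma pow_finsum:
  assumes "finite S" "\<And>x. x \<in> S \<Longrightarrow> f x \<in> carrier A"
  shows "(\<tau> ^^ i) (\<Oplus>x\<in>S. f x) = (\<Oplus>x\<in>S. (\<tau> ^^ i) (f x))"
  using assms by (induction S rule: finite_induct) (auto simp: pow_add Pi_def)

lemma carrier_skew: "carrier P = up A"
  by (simp add: skew_poly_ring_def)

lemma add_skew: "f \<oplus>\<^bsub>P\<^esub> g = (\<lambda>n. f n \<oplus> g n)"
  by (simp add: skew_poly_ring_def)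

lemma mult_skew: "f \<otimes>\<^bsub>P\<^esub> g = (\<lambda>n. \<Oplus>i\<in>{..n}. f i \<otimes> (\<tau> ^^ i) (g (n - i)))"
  by (simp add: skew_poly_ring_def)

lemma one_skew: "\<one>\<^bsub>P\<^esub> = (\<lambda>n. if n = 0 then \<one> else \<zero>)"
  by (simp add: skew_poly_ring_def)

lemma zero_skew: "\<zero>\<^bsub>P\<^esub> = (\<lambda>n. \<zero>)"
  by (simp add: skew_poly_ring_def)

lemmas skew_ops = add_skew mult_skew one_skew zero_skew

lemma up_coeff [simp, intro]: "f \<in> up A \<Longrightarrow> f i \<in> carrier A"
  by (rule mem_upD)

lemma mult_skew_bound:
  assumes "f \<in> up A" "g \<in> up A" "bound \<zero> N f" "bound \<zero> M g"
  shows "bound \<zero> (N + M) (f \<otimes>\<^bsub>P\<^esub> g)"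
proof
  fix n assume n: "N + M < n"
  have "f i \<otimes> (\<tau> ^^ i) (g (n - i)) = \<zero>" if "i \<le> n" for i
  proof (cases "N < i")
    case True
    then have "f i = \<zero>" using assms(3) by (auto simp: bound_def)
    then show ?thesis using assms(2) by simp
  next
    case False
    then have "g (n - i) = \<zero>" using assms(4) n by (auto simp: bound_def)
    then show ?thesis using assms(1) by simp
  qed
  then have "(\<Oplus>i\<in>{..n}. f i \<otimes> (\<tau> ^^ i) (g (n - i))) = (\<Oplus>i\<in>{..n}. \<zero>)"
    by (intro finsum_cong) (auto simp: simp_implies_def)
  then show "(f \<otimes>\<^bsub>P\<^esub> g) n = \<zero>" by (simp add: mult_skew)
qed

lemma mult_skew_closed:
  assumes "f \<in> up A" "g \<in> up A"
  shows "f \<otimes>\<^bsub>P\<^esub> g \<in> up A"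
proof (rule mem_upI)
  show "(f \<otimes>\<^bsub>P\<^esub> g) n \<in> carrier A" for n using assms by (auto simp: mult_skew)
  show "\<exists>n. bound \<zero> n (f \<otimes>\<^bsub>P\<^esub> g)"
    using mult_skew_bound[OF assms] bound_upD[OF assms(1)] bound_upD[OF assms(2)] by blast
qed

lemma mult_skew_assoc:
  assumes "f \<in> up A" "g \<in> up A" "h \<in> up A"
  shows "(f \<otimes>\<^bsub>P\<^esub> g) \<otimes>\<^bsub>P\<^esub> h = f \<otimes>\<^bsub>P\<^esub> (g \<otimes>\<^bsub>P\<^esub> h)"
proof
  fix n
  \<comment> \<open>The term common to both bracketings: the coefficient of \<open>h\<close> has
    been moved past \<open>z ^ j\<close> and \<open>z ^ i\<close>, hence the twist by
    \<open>\<tau> ^^ (j + i)\<close>.\<close>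
  define T where "T j i = f j \<otimes> (\<tau> ^^ j) (g i) \<otimes> (\<tau> ^^ (j + i)) (h (n - j - i))" for j i
  have T: "T j i \<in> carrier A" for j i using assms by (simp add: T_def)
  have "((f \<otimes>\<^bsub>P\<^esub> g) \<otimes>\<^bsub>P\<^esub> h) n = (\<Oplus>i\<in>{..n}. \<Oplus>j\<in>{..i}. T j (i - j))"
    unfolding mult_skew
  proof (intro finsum_cong' refl)
    show "(\<lambda>i. \<Oplus>j\<in>{..i}. T j (i - j)) \<in> {..n} \<rightarrow> carrier A" using T by auto
    fix i assume "i \<in> {..n}"
    have "(\<Oplus>j\<in>{..i}. f j \<otimes> (\<tau> ^^ j) (g (i - j))) \<otimes> (\<tau> ^^ i) (h (n - i)) =
        (\<Oplus>j\<in>{..i}. f j \<otimes> (\<tau> ^^ j) (g (i - j)) \<otimes> (\<tau> ^^ i) (h (n - i)))"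
      using assms by (intro finsum_ldistr) auto
    also have "\<dots> = (\<Oplus>j\<in>{..i}. T j (i - j))"
      using assms by (intro finsum_cong) (auto simp: T_def simp_implies_def)
    finally show "(\<Oplus>j\<in>{..i}. f j \<otimes> (\<tau> ^^ j) (g (i - j))) \<otimes> (\<tau> ^^ i) (h (n - i)) =
        (\<Oplus>j\<in>{..i}. T j (i - j))" .
  qed
  also have "\<dots> = (\<Oplus>j\<in>{..n}. \<Oplus>i\<in>{..n - j}. T j i)" by (rule finsum_triangle[OF T])
  also have "\<dots> = (f \<otimes>\<^bsub>P\<^esub> (g \<otimes>\<^bsub>P\<^esub> h)) n"
    unfolding mult_skew
  proof (intro finsum_cong' refl)
    show "(\<lambda>j. f j \<otimes> (\<tau> ^^ j) (\<Oplus>i\<in>{..n - j}. g i \<otimes> (\<tau> ^^ i) (h (n - j - i)))) \<in> {..n} \<rightarrow> carrier A"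
      using assms by auto
    fix j assume "j \<in> {..n}"
    have "f j \<otimes> (\<tau> ^^ j) (\<Oplus>i\<in>{..n - j}. g i \<otimes> (\<tau> ^^ i) (h (n - j - i))) =
        f j \<otimes> (\<Oplus>i\<in>{..n - j}. (\<tau> ^^ j) (g i \<otimes> (\<tau> ^^ i) (h (n - j - i))))"
      using assms by (subst pow_finsum) auto
    also have "\<dots> = (\<Oplus>i\<in>{..n - j}. f j \<otimes> (\<tau> ^^ j) (g i \<otimes> (\<tau> ^^ i) (h (n - j - i))))"
      using assms by (intro finsum_rdistr) auto
    also have "\<dots> = (\<Oplus>i\<in>{..n - j}. T j i)"
      using assms T by (intro finsum_cong) (auto simp: T_def simp_implies_def pow_mult Nat.funpow_add m_assoc)
    finally show "(\<Oplus>i\<in>{..n - j}. T j i) =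
        f j \<otimes> (\<tau> ^^ j) (\<Oplus>i\<in>{..n - j}. g i \<otimes> (\<tau> ^^ i) (h (n - j - i)))" by (rule sym)
  qed
  finally show "((f \<otimes>\<^bsub>P\<^esub> g) \<otimes>\<^bsub>P\<^esub> h) n = (f \<otimes>\<^bsub>P\<^esub> (g \<otimes>\<^bsub>P\<^esub> h)) n" .
qed

lemma skew_poly_ring_is_ring: "ring P"
proof (rule ringI)
  show "abelian_group P"
  proof (rule abelian_groupI, unfold carrier_skew)
    fix f assume f: "f \<in> up A"
    have "(\<lambda>i. \<ominus> f i) \<oplus>\<^bsub>P\<^esub> f = \<zero>\<^bsub>P\<^esub>" using f by (auto simp: skew_ops l_neg)
    then show "\<exists>g\<in>up A. g \<oplus>\<^bsub>P\<^esub> f = \<zero>\<^bsub>P\<^esub>" using up_a_inv_closed[OF f] by blast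
  qed (auto simp: skew_ops up_add_closed a_ac)
  show "monoid P"
  proof (rule monoidI, unfold carrier_skew)
    fix f assume f: "f \<in> up A"
    have "(\<Oplus>i\<in>{..n}. (if i = 0 then \<one> else \<zero>) \<otimes> (\<tau> ^^ i) (f (n - i))) =
        (\<Oplus>i\<in>{..n}. if 0 = i then f (n - i) else \<zero>)" for n
      using f by (intro finsum_cong) (auto simp: simp_implies_def)
    moreover have "(\<Oplus>i\<in>{..n}. if 0 = i then f (n - i) else \<zero>) = f (n - 0)" for n
      using f by (intro add.finprod_singleton) auto
    ultimately show "\<one>\<^bsub>P\<^esub> \<otimes>\<^bsub>P\<^esub> f = f" by (simp add: skew_ops)
    have "(\<Oplus>i\<in>{..n}. f i \<otimes> (\<tau> ^^ i) (if n - i = 0 then \<one> else \<zero>)) =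
        (\<Oplus>i\<in>{..n}. if n = i then f i else \<zero>)" for n
      using f by (intro finsum_cong) (auto simp: simp_implies_def)
    moreover have "(\<Oplus>i\<in>{..n}. if n = i then f i else \<zero>) = f n" for n
      using f by (intro add.finprod_singleton) auto
    ultimately show "f \<otimes>\<^bsub>P\<^esub> \<one>\<^bsub>P\<^esub> = f" by (simp add: skew_ops)
  qed (auto simp: one_skew up_one_closed mult_skew_closed mult_skew_assoc)
qed (auto simp: carrier_skew add_skew mult_skew l_distr r_distr pow_add finsum_addf
    intro!: finsum_addf[symmetric] trans[OF finsum_cong[OF refl] finsum_addf])

end

text \<open>Skew polynomials become operators on \<open>L\<close>: \<open>z\<close> acts as \<open>\<sigma>\<close> and coefficients act
  by multiplication, through the homomorphism \<open>ev\<close>.\<close>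

locale skew_evaluation = skew_coefficients A \<tau> + S: subfield_automorphism L K \<sigma> m
  for A :: "('b, 'c) ring_scheme" (structure) and \<tau> and L K :: "'a::field set" and \<sigma> m +
  fixes ev :: "'b \<Rightarrow> 'a"
  assumes ev_closed [simp]: "x \<in> carrier A \<Longrightarrow> ev x \<in> L"
    and ev_add: "x \<in> carrier A \<Longrightarrow> y \<in> carrier A \<Longrightarrow> ev (x \<oplus> y) = ev x + ev y"
    and ev_mult: "x \<in> carrier A \<Longrightarrow> y \<in> carrier A \<Longrightarrow> ev (x \<otimes> y) = ev x * ev y"
    and ev_one: "ev \<one> = 1"
    and ev_endo: "x \<in> carrier A \<Longrightarrow> ev (\<tau> x) = \<sigma> (ev x)"
begin

lemma ev_zero [simp]: "ev \<zero> = 0"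
proof -
  have "ev \<zero> + ev \<zero> = ev \<zero> + 0"
    using ev_add[of \<zero> \<zero>] by (simp only: zero_closed l_zero add_0_right)
  then show ?thesis by (rule add_left_imp_eq)
qed

lemma ev_finsum:
  "finite I \<Longrightarrow> (\<And>i. i \<in> I \<Longrightarrow> f i \<in> carrier A) \<Longrightarrow> ev (\<Oplus>i\<in>I. f i) = (\<Sum>i\<in>I. ev (f i))"
  by (induction I rule: finite_induct) (auto simp: ev_add Pi_def)

lemma ev_pow: "x \<in> carrier A \<Longrightarrow> ev ((\<tau> ^^ i) x) = (\<sigma> ^^ i) (ev x)"
  by (induction i) (auto simp: ev_endo)

text \<open>Summing over the nonzero evaluated coefficients avoids choosing a degree bound; this set
  is finite for elements of \<open>up A\<close>, and any valid bound may replace it.\<close>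

definition act :: "(nat \<Rightarrow> 'b) \<Rightarrow> 'a \<Rightarrow> 'a"
  where "act f y = (\<Sum>j | ev (f j) \<noteq> 0. ev (f j) * (\<sigma> ^^ j) y)"

lemma act_eq:
  assumes "\<And>j. N < j \<Longrightarrow> ev (f j) = 0"
  shows "act f y = (\<Sum>j\<le>N. ev (f j) * (\<sigma> ^^ j) y)"
  unfolding act_def using assms
  by (intro sum.mono_neutral_left) (auto, metis not_le_imp_less)

lemma act_eq_bound:
  "bound \<zero> N f \<Longrightarrow> act f y = (\<Sum>j\<le>N. ev (f j) * (\<sigma> ^^ j) y)"
  by (rule act_eq) (auto simp: bound_def)

lemma act_closed: "f \<in> up A \<Longrightarrow> y \<in> L \<Longrightarrow> act f y \<in> L"
  unfolding act_def by (intro S.sum_closed) auto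

lemma act_add:
  assumes "f \<in> up A" "g \<in> up A"
  shows "act (f \<oplus>\<^bsub>P\<^esub> g) y = act f y + act g y"
proof -
  obtain N M where b: "bound \<zero> N f" "bound \<zero> M g"
    using bound_upD[OF assms(1)] bound_upD[OF assms(2)] by blast
  have "bound \<zero> (max N M) f" "bound \<zero> (max N M) g" "bound \<zero> (max N M) (f \<oplus>\<^bsub>P\<^esub> g)"
    using b by (auto simp: bound_def add_skew)
  then show ?thesis
    using assms by (simp add: act_eq_bound add_skew ev_add distrib_right sum.distrib)
qed

text \<open>The commutation rule of the skew ring is the composition rule of operators:
  \<open>\<sigma> ^^ i\<close> sends \<open>ev b * (\<sigma> ^^ j) y\<close> to
  \<open>(\<sigma> ^^ i) (ev b) * (\<sigma> ^^ (i + j)) y\<close>, and \<open>ev\<close> turns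
  \<open>\<tau>\<close> into \<open>\<sigma>\<close>.\<close>

lemma act_mult:
  assumes "f \<in> up A" "g \<in> up A" "y \<in> L"
  shows "act (f \<otimes>\<^bsub>P\<^esub> g) y = act f (act g y)"
proof -
  obtain N M where b: "bound \<zero> N f" "bound \<zero> M g"
    using bound_upD[OF assms(1)] bound_upD[OF assms(2)] by blast
  define T where "T i j = ev (f i) * (\<sigma> ^^ i) (ev (g j)) * (\<sigma> ^^ (i + j)) y" for i j
  have "act (f \<otimes>\<^bsub>P\<^esub> g) y = (\<Sum>n\<le>N + M. ev ((f \<otimes>\<^bsub>P\<^esub> g) n) * (\<sigma> ^^ n) y)"
    by (rule act_eq_bound[OF mult_skew_bound[OF assms(1,2) b]])
  also have "\<dots> = (\<Sum>n\<le>N + M. \<Sum>i\<le>n. T i (n - i))"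
  proof (intro sum.cong refl)
    fix n
    have "ev ((f \<otimes>\<^bsub>P\<^esub> g) n) = (\<Sum>i\<le>n. ev (f i) * (\<sigma> ^^ i) (ev (g (n - i))))"
      unfolding mult_skew using assms
      by (subst ev_finsum) (auto simp: ev_mult ev_pow)
    then show "ev ((f \<otimes>\<^bsub>P\<^esub> g) n) * (\<sigma> ^^ n) y = (\<Sum>i\<le>n. T i (n - i))"
      by (simp add: T_def sum_distrib_right)
  qed
  also have "\<dots> = (\<Sum>(i, j)\<in>{(i, j). i + j \<le> N + M}. T i j)"
    by (rule sum.triangle_reindex_eq[symmetric])
  also have "\<dots> = (\<Sum>(i, j)\<in>{..N} \<times> {..M}. T i j)"
  proof (rule sum.mono_neutral_right)
    show "finite {(i, j). i + j \<le> N + M}"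
      by (rule finite_subset[of _ "{..N + M} \<times> {..N + M}"]) auto
    show "\<forall>p\<in>{(i, j). i + j \<le> N + M} - {..N} \<times> {..M}. (case p of (i, j) \<Rightarrow> T i j) = 0"
    proof
      fix p assume p: "p \<in> {(i, j). i + j \<le> N + M} - {..N} \<times> {..M}"
      obtain i j where ij: "p = (i, j)" by force
      then have "f i = \<zero> \<or> g j = \<zero>" using p b by (auto simp: bound_def not_le)
      then show "(case p of (i, j) \<Rightarrow> T i j) = 0" by (auto simp: T_def ij)
    qed
  qed auto
  also have "\<dots> = (\<Sum>i\<le>N. \<Sum>j\<le>M. T i j)" by (simp add: sum.cartesian_product)
  also have "\<dots> = (\<Sum>i\<le>N. ev (f i) * (\<sigma> ^^ i) (act g y))"
  proof (intro sum.cong refl)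
    fix i
    have "(\<sigma> ^^ i) (act g y) = (\<Sum>j\<le>M. (\<sigma> ^^ i) (ev (g j)) * (\<sigma> ^^ (i + j)) y)"
      unfolding act_eq_bound[OF b(2)] using assms
      by (subst S.funpow_sum) (auto simp: S.iterate_mult funpow_add)
    then show "(\<Sum>j\<le>M. T i j) = ev (f i) * (\<sigma> ^^ i) (act g y)"
      by (simp add: T_def sum_distrib_left mult.assoc)
  qed
  also have "\<dots> = act f (act g y)" by (rule act_eq_bound[OF b(1), symmetric])
  finally show ?thesis .
qed

lemma act_zero_right [simp]: "act f 0 = 0"
  by (simp add: act_def)

text \<open>Demanding zero on all of \<open>L\<close> makes the ideal two-sided: in a product with
  the annihilator on the left, it is applied to \<open>act g y\<close>, which is again in
  \<open>L\<close>.\<close>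

lemma annihilator_ideal: "ideal {f \<in> up A. \<forall>y\<in>L. act f y = 0} P"
proof -
  interpret PR: ring P by (rule skew_poly_ring_is_ring)
  have inv: "act (\<ominus>\<^bsub>P\<^esub> f) y = 0" if "f \<in> up A" "act f y = 0" for f y
  proof -
    have "\<ominus>\<^bsub>P\<^esub> f \<in> up A" using PR.a_inv_closed that(1) by (simp add: carrier_skew)
    then have "act (f \<oplus>\<^bsub>P\<^esub> \<ominus>\<^bsub>P\<^esub> f) y = act f y + act (\<ominus>\<^bsub>P\<^esub> f) y" using that by (intro act_add)
    moreover have "f \<oplus>\<^bsub>P\<^esub> \<ominus>\<^bsub>P\<^esub> f = \<zero>\<^bsub>P\<^esub>" using that(1) by (simp add: PR.r_neg carrier_skew)
    ultimately show ?thesis using that(2) by (simp add: zero_skew act_def)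
  qed
  show ?thesis
  proof (rule idealI[OF PR.ring_axioms])
    show "subgroup {f \<in> up A. \<forall>y\<in>L. act f y = 0} (add_monoid P)"
    proof (rule PR.add.subgroupI)
      show "{f \<in> up A. \<forall>y\<in>L. act f y = 0} \<noteq> {}"
        using PR.zero_closed by (auto simp: carrier_skew zero_skew act_def intro!: exI[of _ "\<lambda>_. \<zero>"])
    qed (use PR.a_closed PR.a_inv_closed inv in \<open>auto simp: carrier_skew act_add\<close>)
  qed (use PR.m_closed in \<open>auto simp: carrier_skew act_mult act_closed\<close>)
qed

lemma skew_var_pow:
  "skew_var A [^]\<^bsub>P\<^esub> n = (\<lambda>i. if i = n then \<one> else \<zero>)"
proof (induction n)
  case 0
  show ?case by (simp add: one_skew eq_commute)
next
  case (Suc n)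
  have "(\<Oplus>j\<in>{..i}. (if j = n then \<one> else \<zero>) \<otimes> (\<tau> ^^ j) (skew_var A (i - j))) =
      (if i = Suc n then \<one> else \<zero>)" for i
  proof -
    have "(\<Oplus>j\<in>{..i}. (if j = n then \<one> else \<zero>) \<otimes> (\<tau> ^^ j) (skew_var A (i - j))) =
        (\<Oplus>j\<in>{..i}. if n = j then (if i = Suc n then \<one> else \<zero>) else \<zero>)"
      by (intro finsum_cong) (auto simp: simp_implies_def skew_var_def)
    also have "\<dots> = (if i = Suc n then \<one> else \<zero>)"
    proof (cases "n \<le> i")
      case True
      then show ?thesis by (intro add.finprod_singleton) auto
    next
      case False
      then have "(\<Oplus>j\<in>{..i}. if n = j then (if i = Suc n then \<one> else \<zero>) else \<zero>) =
          (\<Oplus>j\<in>{..i}. \<zero>)"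
        by (intro finsum_cong') auto
      then show ?thesis using False by simp
    qed
    finally show ?thesis .
  qed
  then show ?case using Suc by (simp add: mult_skew nat_pow_def)
qed

lemma act_skew_var_pow: "act (skew_var A [^]\<^bsub>P\<^esub> n) y = (\<sigma> ^^ n) y"
proof -
  have "{j. ev ((skew_var A [^]\<^bsub>P\<^esub> n) j) \<noteq> 0} = {n}" by (auto simp: skew_var_pow ev_one)
  then show ?thesis by (simp add: act_def skew_var_pow ev_one)
qed

lemma annihilated_by_genideal:
  assumes "f \<in> genideal P {skew_var A [^]\<^bsub>P\<^esub> m \<ominus>\<^bsub>P\<^esub> \<one>\<^bsub>P\<^esub>}" "y \<in> L"
  shows "act f y = 0"
proof -
  interpret PR: ring P by (rule skew_poly_ring_is_ring)
  have var: "skew_var A \<in> up A"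
    by (auto simp: skew_var_def intro!: mem_upI exI[of _ 1])
  let ?d = "skew_var A [^]\<^bsub>P\<^esub> m \<ominus>\<^bsub>P\<^esub> \<one>\<^bsub>P\<^esub>"
  have cl: "skew_var A [^]\<^bsub>P\<^esub> m \<in> carrier P"
    using PR.nat_pow_closed var by (simp add: carrier_skew)
  then have d: "?d \<in> up A" using PR.minus_closed PR.one_closed by (simp add: carrier_skew)
  have "act ?d y = 0" if y: "y \<in> L" for y
  proof -
    \<comment> \<open>The difference is handled by adding 1 back, written as a zeroth power of the
      variable so that one formula covers both actions.\<close>
    have "?d \<oplus>\<^bsub>P\<^esub> skew_var A [^]\<^bsub>P\<^esub> (0::nat) = skew_var A [^]\<^bsub>P\<^esub> m"
      using cl PR.minus_closed by (simp add: PR.minus_eq PR.a_assoc PR.l_neg PR.nat_pow_0)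
    moreover have "act (?d \<oplus>\<^bsub>P\<^esub> skew_var A [^]\<^bsub>P\<^esub> (0::nat)) y = act ?d y + act (skew_var A [^]\<^bsub>P\<^esub> (0::nat)) y"
      using d PR.one_closed by (intro act_add) (auto simp: carrier_skew)
    ultimately have "(\<sigma> ^^ m) y = act ?d y + (\<sigma> ^^ 0) y" by (simp only: act_skew_var_pow)
    then show ?thesis using S.period[OF y] by simp
  qed
  then have "genideal P {?d} \<subseteq> {f \<in> up A. \<forall>y\<in>L. act f y = 0}"
    using d by (intro PR.genideal_minimal annihilator_ideal) auto
  then show ?thesis using assms by auto
qed

text \<open>Membership of the classes means \<open>f = w + u g\<close> with \<open>w\<close> in the
  ideal. The summand \<open>w\<close> kills all of \<open>L\<close>, and \<open>u\<close> is applied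
  to \<open>act g y = 0\<close>, so a single zero of \<open>g\<close> passes to
  \<open>f\<close>.\<close>

lemma act_eq_zero_of_left_multiple:
  assumes "f \<in> up A" "g \<in> up A" "y \<in> L" "act g y = 0"
    and "I = genideal P {skew_var A [^]\<^bsub>P\<^esub> m \<ominus>\<^bsub>P\<^esub> \<one>\<^bsub>P\<^esub>}"
    and "I +>\<^bsub>P\<^esub> f \<in> PIdl\<^bsub>P Quot I\<^esub> (I +>\<^bsub>P\<^esub> g)"
  shows "act f y = 0"
proof -
  interpret PR: ring P by (rule skew_poly_ring_is_ring)
  have var: "skew_var A \<in> up A"
    by (auto simp: skew_var_def intro!: mem_upI exI[of _ 1])
  then have "skew_var A [^]\<^bsub>P\<^esub> m \<ominus>\<^bsub>P\<^esub> \<one>\<^bsub>P\<^esub> \<in> carrier P"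
    using PR.nat_pow_closed PR.minus_closed PR.one_closed by (simp add: carrier_skew)
  then interpret I: ideal I P unfolding assms(5) by (intro PR.genideal_ideal) auto
  obtain Q where Q: "Q \<in> carrier (P Quot I)" "I +>\<^bsub>P\<^esub> f = Q \<otimes>\<^bsub>P Quot I\<^esub> (I +>\<^bsub>P\<^esub> g)"
    using assms(6) by (auto simp: cgenideal_def)
  then obtain u where u: "u \<in> carrier P" "Q = I +>\<^bsub>P\<^esub> u"
    by (auto simp: FactRing_def A_RCOSETS_def')
  have "I +>\<^bsub>P\<^esub> f = I +>\<^bsub>P\<^esub> (u \<otimes>\<^bsub>P\<^esub> g)"
    using Q(2) u assms(2) I.rcoset_mult_add[of u g] by (simp add: FactRing_def carrier_skew)
  moreover have "f \<in> I +>\<^bsub>P\<^esub> f"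
    using assms(1) by (intro I.a_rcos_self) (simp add: carrier_skew)
  ultimately obtain w where w: "w \<in> I" "f = w \<oplus>\<^bsub>P\<^esub> (u \<otimes>\<^bsub>P\<^esub> g)"
    by (auto simp: a_r_coset_def')
  have "act f y = act w y + act u (act g y)"
    unfolding w(2) using I.Icarr[OF w(1)] u(1) assms(2,3) PR.m_closed
    by (simp add: act_add act_mult carrier_skew)
  then show ?thesis using annihilated_by_genideal[of w y] w(1) assms(3-5) by simp
qed

end

section \<open>Residue classes of polynomials\<close>

lemma poly_eq_sum_bounded:
  fixes p :: "'a::field poly"
  assumes "\<And>i. N < i \<Longrightarrow> poly.coeff p i = 0"
  shows "poly p x = (\<Sum>i\<le>N. poly.coeff p i * x ^ i)"
  unfolding poly_altdef using assms
  by (intro sum.mono_neutral_left) (auto simp: coeff_eq_0 intro: Polynomial.degree_le)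

lemma (in ambient_subfield) polys_over_mult_closed:
  assumes "\<forall>i. poly.coeff p i \<in> L" "\<forall>i. poly.coeff q i \<in> L"
  shows "poly.coeff (p * q) i \<in> L"
  using assms by (simp add: coeff_mult)

lemmas polys_over_simps = polys_over_def ring_of_type_algebra_def

lemma (in ambient_subfield) polys_over_cring: "cring (polys_over L)"
proof (rule cringI)
  show "abelian_group (polys_over L)"
  proof (rule abelian_groupI)
    fix p assume "p \<in> carrier (polys_over L)"
    then show "\<exists>q\<in>carrier (polys_over L). q \<oplus>\<^bsub>polys_over L\<^esub> p = \<zero>\<^bsub>polys_over L\<^esub>"
      by (intro bexI[of _ "- p"]) (auto simp: polys_over_simps)
  qed (auto simp: polys_over_simps)
  show "comm_monoid (polys_over L)"
    by (rule comm_monoidI)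
      (auto simp: polys_over_simps polys_over_mult_closed mult.assoc mult.commute of_bool_def
        polys_over_def if_distrib)
qed (auto simp: polys_over_simps distrib_right)

abbreviation x_pow_minus_1 :: "nat \<Rightarrow> 'a::field poly"
  where "x_pow_minus_1 l \<equiv> Polynomial.monom 1 l - 1"

text \<open>Evaluation through an arbitrary representative; for \<open>a ^ l = 1\<close> the choice
  is immaterial, as representatives differ by multiples of \<open>x_pow_minus_1 l\<close>.\<close>

definition eval_class :: "'a::field \<Rightarrow> 'a poly set \<Rightarrow> 'a"
  where "eval_class a P = poly (SOME p. p \<in> P) a"

context ambient_subfield
begin

lemma x_pow_minus_1_closed: "poly.coeff (x_pow_minus_1 l) i \<in> L"
  by (simp add: of_bool_def if_distrib split: if_splits)

lemma S_ideal_ideal: "ideal (S_ideal L l) (polys_over L)"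
proof -
  interpret PL: cring "polys_over L" by (rule polys_over_cring)
  show ?thesis unfolding S_ideal_def
    by (rule PL.genideal_ideal) (use x_pow_minus_1_closed in \<open>auto simp: polys_over_simps\<close>)
qed

lemma S_ring_cring: "cring (S_ring L l)"
  unfolding S_ring_def using S_ideal_ideal polys_over_cring by (rule ideal.quotient_is_cring)

lemma S_class_hom: "S_class L l \<in> Ring.ring_hom (polys_over L) (S_ring L l)"
  using ideal.rcos_ring_hom[OF S_ideal_ideal, of l] unfolding S_ring_def S_class_def[abs_def] .

lemma S_class_eq:
  "S_class L l p = {q * x_pow_minus_1 l + p | q. \<forall>i. poly.coeff q i \<in> L}"
proof -
  interpret PL: cring "polys_over L" by (rule polys_over_cring)
  have "S_ideal L l = PIdl\<^bsub>polys_over L\<^esub> (x_pow_minus_1 l)"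
    unfolding S_ideal_def
    by (rule PL.cgenideal_eq_genideal[symmetric])
      (use x_pow_minus_1_closed in \<open>auto simp: polys_over_simps\<close>)
  then show ?thesis
    by (auto simp: S_class_def a_r_coset_def' cgenideal_def polys_over_simps)
qed

lemma S_ring_carrierE:
  assumes "P \<in> carrier (S_ring L l)"
  obtains p where "\<forall>i. poly.coeff p i \<in> L" "P = S_class L l p"
  using assms by (auto simp: S_ring_def FactRing_def A_RCOSETS_def' S_class_def polys_over_simps)

lemma S_class_ops:
  assumes "\<forall>i. poly.coeff p i \<in> L" "\<forall>i. poly.coeff q i \<in> L"
  shows "S_class L l p \<oplus>\<^bsub>S_ring L l\<^esub> S_class L l q = S_class L l (p + q)"
    and "S_class L l p \<otimes>\<^bsub>S_ring L l\<^esub> S_class L l q = S_class L l (p * q)"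
  using ring_hom_add[OF S_class_hom, of p q] ring_hom_mult[OF S_class_hom, of p q] assms
  by (auto simp: polys_over_simps)

lemma S_class_one: "\<one>\<^bsub>S_ring L l\<^esub> = S_class L l 1"
  using ring_hom_one[OF S_class_hom, of l] by (simp add: polys_over_simps)

lemma S_class_zero: "\<zero>\<^bsub>S_ring L l\<^esub> = S_class L l 0"
proof -
  interpret PL: cring "polys_over L" by (rule polys_over_cring)
  interpret SL: cring "S_ring L l" by (rule S_ring_cring)
  show ?thesis
    using ring_hom_zero[OF S_class_hom PL.ring_axioms SL.ring_axioms] by (simp add: polys_over_simps)
qed

lemma S_class_closed: "\<forall>i. poly.coeff p i \<in> L \<Longrightarrow> S_class L l p \<in> carrier (S_ring L l)"
  using ring_hom_closed[OF S_class_hom, of p l] by (simp add: polys_over_simps)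

lemma eval_class_S_class:
  assumes "a ^ l = 1"
  shows "eval_class a (S_class L l p) = poly p a"
proof -
  have "p \<in> S_class L l p" unfolding S_class_eq by (auto intro!: exI[of _ 0])
  then have "(SOME p'. p' \<in> S_class L l p) \<in> S_class L l p" by (rule someI)
  then show ?thesis
    unfolding eval_class_def using assms by (auto simp: S_class_eq poly_monom)
qed

end

context subfield_automorphism
begin

lemma coeff_map [simp]: "poly.coeff (map_poly \<tau> p) i = \<tau> (poly.coeff p i)"
  by (simp add: coeff_map_poly)

lemma map_poly_add:
  "\<forall>i. poly.coeff p i \<in> L \<Longrightarrow> \<forall>i. poly.coeff q i \<in> L \<Longrightarrow>
    map_poly \<tau> (p + q) = map_poly \<tau> p + map_poly \<tau> q"
  by (intro poly_eqI) (simp add: hom_add)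

lemma map_poly_mult:
  "\<forall>i. poly.coeff p i \<in> L \<Longrightarrow> \<forall>i. poly.coeff q i \<in> L \<Longrightarrow>
    map_poly \<tau> (p * q) = map_poly \<tau> p * map_poly \<tau> q"
  by (intro poly_eqI) (simp add: coeff_mult hom_sum hom_mult)

lemma map_poly_x_pow_minus_1: "map_poly \<tau> (x_pow_minus_1 l) = x_pow_minus_1 l"
proof (intro poly_eqI)
  fix i
  have "poly.coeff (x_pow_minus_1 l) i \<in> K"
    using hom_add[of 1 "- 1"] hom_one x_pow_minus_1_closed
    by (auto intro!: fixedI simp: of_bool_def eq_neg_iff_add_eq_0 add.commute)
  then show "poly.coeff (map_poly \<tau> (x_pow_minus_1 l)) i = poly.coeff (x_pow_minus_1 l) i" by simp
qed

text \<open>\<open>S_aut\<close> is a set image, so reaching the whole target class requires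
  \<open>\<tau>\<close> to be onto \<open>L\<close>; the iterate \<open>\<tau> ^^ (m - 1)\<close>
  supplies preimages.\<close>

lemma S_aut_S_class:
  assumes "m > 0" "\<forall>i. poly.coeff p i \<in> L"
  shows "S_aut \<tau> (S_class L l p) = S_class L l (map_poly \<tau> p)"
proof -
  have hom: "map_poly \<tau> (q * x_pow_minus_1 l + p) = map_poly \<tau> q * x_pow_minus_1 l + map_poly \<tau> p"
    if "\<forall>i. poly.coeff q i \<in> L" for q
    using that assms(2) x_pow_minus_1_closed polys_over_mult_closed[OF that, of "x_pow_minus_1 l"]
    by (simp add: map_poly_add map_poly_mult map_poly_x_pow_minus_1 del: coeff_diff)
  have surj: "\<exists>q'. (\<forall>i. poly.coeff q' i \<in> L) \<and> q = map_poly \<tau> q'" if "\<forall>i. poly.coeff q i \<in> L" for q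
  proof (intro exI conjI)
    show "q = map_poly \<tau> (map_poly (\<tau> ^^ (m - 1)) q)"
    proof (intro poly_eqI)
      fix i
      have "\<tau> ((\<tau> ^^ (m - 1)) (poly.coeff q i)) = (\<tau> ^^ m) (poly.coeff q i)"
        using assms(1) by (cases m) auto
      then show "poly.coeff q i = poly.coeff (map_poly \<tau> (map_poly (\<tau> ^^ (m - 1)) q)) i"
        using period that by (simp add: coeff_map_poly)
    qed
  qed (use that in \<open>simp add: coeff_map_poly\<close>)
  show ?thesis
  proof
    show "S_aut \<tau> (S_class L l p) \<subseteq> S_class L l (map_poly \<tau> p)"
    proof
      fix f assume "f \<in> S_aut \<tau> (S_class L l p)"
      then obtain q where q: "\<forall>i. poly.coeff q i \<in> L" "f = map_poly \<tau> (q * x_pow_minus_1 l + p)"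
        unfolding S_aut_def S_class_eq by blast
      show "f \<in> S_class L l (map_poly \<tau> p)"
        unfolding S_class_eq q(2) hom[OF q(1)] mem_Collect_eq
        by (rule exI[of _ "map_poly \<tau> q"]) (use q(1) in simp)
    qed
    show "S_class L l (map_poly \<tau> p) \<subseteq> S_aut \<tau> (S_class L l p)"
    proof
      fix f assume "f \<in> S_class L l (map_poly \<tau> p)"
      then obtain q where q: "\<forall>i. poly.coeff q i \<in> L" "f = q * x_pow_minus_1 l + map_poly \<tau> p"
        unfolding S_class_eq by blast
      obtain q' where q': "\<forall>i. poly.coeff q' i \<in> L" "q = map_poly \<tau> q'" using surj[OF q(1)] by blast
      show "f \<in> S_aut \<tau> (S_class L l p)"
        unfolding S_aut_def S_class_eq q(2) q'(2) hom[OF q'(1), symmetric]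
        using q'(1) by blast
    qed
  qed
qed

lemma S_aut_hom:
  assumes "m > 0"
  shows "S_aut \<tau> \<in> Ring.ring_hom (S_ring L l) (S_ring L l)"
proof (rule ring_hom_memI)
  fix Q R assume "Q \<in> carrier (S_ring L l)" "R \<in> carrier (S_ring L l)"
  then obtain q r where qr: "\<forall>i. poly.coeff q i \<in> L" "Q = S_class L l q"
      "\<forall>i. poly.coeff r i \<in> L" "R = S_class L l r"
    by (elim S_ring_carrierE)
  then show "S_aut \<tau> (Q \<oplus>\<^bsub>S_ring L l\<^esub> R) = S_aut \<tau> Q \<oplus>\<^bsub>S_ring L l\<^esub> S_aut \<tau> R"
    and "S_aut \<tau> (Q \<otimes>\<^bsub>S_ring L l\<^esub> R) = S_aut \<tau> Q \<otimes>\<^bsub>S_ring L l\<^esub> S_aut \<tau> R"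
    using assms polys_over_mult_closed[of q r]
    by (simp_all add: S_class_ops S_aut_S_class map_poly_add map_poly_mult)
next
  fix Q assume "Q \<in> carrier (S_ring L l)"
  then obtain q where "\<forall>i. poly.coeff q i \<in> L" "Q = S_class L l q" by (elim S_ring_carrierE)
  then show "S_aut \<tau> Q \<in> carrier (S_ring L l)"
    using assms by (simp add: S_aut_S_class S_class_closed)
next
  have "map_poly \<tau> 1 = 1" by (intro poly_eqI) (simp add: of_bool_def hom_one)
  moreover have "\<forall>i. poly.coeff 1 i \<in> L" by (simp add: of_bool_def)
  ultimately show "S_aut \<tau> \<one>\<^bsub>S_ring L l\<^esub> = \<one>\<^bsub>S_ring L l\<^esub>"
    using assms by (simp add: S_class_one S_aut_S_class)
qed

end

section \<open>Vanishing of codewords on the defining set\<close>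

text \<open>Since \<open>\<sigma>\<close> fixes \<open>a\<close> and extends
  \<open>\<theta>\<close>, evaluation at \<open>x = a\<close> turns the twist of \<open>S'\<close>
  into \<open>\<sigma>\<close>, and skew polynomials over \<open>S'\<close> act on \<open>L\<close>.
  The sums are those of \<open>Ev\<close> without the factor \<open>inverse \<beta>\<close>, which
  makes them additive in \<open>y\<close>.\<close>

lemma codeword_evaluation_zero:
  fixes F K L :: "'a::field set" and g :: "'a poly poly"
  assumes "subfield_automorphism L K \<sigma> m" "subfield_automorphism F E \<theta> m" "m > 0"
    and "F \<subseteq> L" "\<And>x. x \<in> F \<Longrightarrow> \<theta> x = \<sigma> x" "a \<in> K" "a ^ l = 1"
    and "generates_code F \<theta> m l g C" "c \<in> C"
    and "\<And>i j. i < l \<Longrightarrow> j < m \<Longrightarrow> entry m c i j \<in> F" "y \<in> L"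
    and "(\<Sum>j\<le>Polynomial.degree g. poly (poly.coeff g j) a * (\<sigma> ^^ j) y) = 0"
  shows "(\<Sum>j<m. \<Sum>i<l. entry m c i j * a ^ i * (\<sigma> ^^ j) y) = 0"
proof -
  interpret S: subfield_automorphism L K \<sigma> m by fact
  interpret T: subfield_automorphism F E \<theta> m by fact
  interpret SF: cring "S_ring F l" by (rule T.S_ring_cring)
  have aL: "a \<in> L" using assms(6) by simp
  have polyL: "poly p a \<in> L" if "\<forall>i. poly.coeff p i \<in> F" for p
    unfolding poly_altdef using that aL assms(4) by (intro S.sum_closed) auto
  have poly_map: "poly (map_poly \<theta> p) a = \<sigma> (poly p a)" if p: "\<forall>i. poly.coeff p i \<in> F" for p
  proof -
    have "poly.coeff p i * a ^ i \<in> L" "\<sigma> (poly.coeff p i * a ^ i) = \<theta> (poly.coeff p i) * a ^ i" for i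
      using p[rule_format, of i] assms(4-6) by (auto simp: S.hom_mult subset_iff)
    note terms = this
    have "poly (map_poly \<theta> p) a = (\<Sum>i\<le>Polynomial.degree p. poly.coeff (map_poly \<theta> p) i * a ^ i)"
      by (rule poly_eq_sum_bounded) (simp add: coeff_eq_0)
    also have "\<dots> = \<sigma> (poly p a)"
      unfolding poly_altdef using terms by (subst S.hom_sum) simp_all
    finally show ?thesis .
  qed
  interpret SE: skew_evaluation "S_ring F l" "S_aut \<theta>" L K \<sigma> m "eval_class a"
  proof unfold_locales
    show "S_aut \<theta> \<in> Ring.ring_hom (S_ring F l) (S_ring F l)"
      using assms(3) by (rule T.S_aut_hom)
    fix P Q assume "P \<in> carrier (S_ring F l)"
    then obtain p where p: "\<forall>i. poly.coeff p i \<in> F" "P = S_class F l p" by (elim T.S_ring_carrierE)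
    show "eval_class a P \<in> L" using p polyL T.eval_class_S_class[OF assms(7)] by simp
    show "eval_class a (S_aut \<theta> P) = \<sigma> (eval_class a P)"
      using p assms(3) by (simp add: T.S_aut_S_class T.eval_class_S_class[OF assms(7)] poly_map)
    assume "Q \<in> carrier (S_ring F l)"
    then obtain q where q: "\<forall>i. poly.coeff q i \<in> F" "Q = S_class F l q" by (elim T.S_ring_carrierE)
    show "eval_class a (P \<oplus>\<^bsub>S_ring F l\<^esub> Q) = eval_class a P + eval_class a Q"
      and "eval_class a (P \<otimes>\<^bsub>S_ring F l\<^esub> Q) = eval_class a P * eval_class a Q"
      using p q by (simp_all add: T.S_class_ops T.eval_class_S_class[OF assms(7)])
  next
    show "eval_class a \<one>\<^bsub>S_ring F l\<^esub> = 1"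
      by (simp add: T.S_class_one T.eval_class_S_class[OF assms(7)])
  qed
  define f where "f G = (\<lambda>j. S_class F l (poly.coeff G j))" for G :: "'a poly poly"
  have f_bound: "bound \<zero>\<^bsub>S_ring F l\<^esub> (Polynomial.degree G) (f G)" for G
    by (auto simp: f_def T.S_class_zero coeff_eq_0)
  have f_up: "f G \<in> up (S_ring F l)" if "\<forall>i j. poly.coeff (poly.coeff G j) i \<in> F" for G
  proof (rule mem_upI)
    show "f G i \<in> carrier (S_ring F l)" for i using that by (simp add: f_def T.S_class_closed)
    show "\<exists>n. bound \<zero>\<^bsub>S_ring F l\<^esub> n (f G)" using f_bound by blast
  qed
  have act_f: "SE.act (f G) y = (\<Sum>j\<le>N. poly (poly.coeff G j) a * (\<sigma> ^^ j) y)"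
    if "\<And>j. N < j \<Longrightarrow> poly.coeff G j = 0" for G N
    using that by (subst SE.act_eq[of N]) (auto simp: f_def T.eval_class_S_class[OF assms(7)])
  define G where "G = (\<Sum>j<m. Polynomial.monom (\<Sum>i<l. Polynomial.monom (entry m c i j) i) j)"
  have coeffG: "poly.coeff G j =
      (if j < m then \<Sum>i<l. Polynomial.monom (entry m c i j) i else 0)" for j
    unfolding G_def by (simp add: coeff_sum)
  have G_up: "f G \<in> up (S_ring F l)"
    using assms(10) by (intro f_up) (auto simp: coeffG coeff_sum if_distrib cong: if_cong)
  have g_up: "f g \<in> up (S_ring F l)"
    using assms(8) by (intro f_up) (auto simp: generates_code_def)
  have "nu F \<theta> m l c \<in> PIdl\<^bsub>R_ring F \<theta> m l\<^esub> (R_class F \<theta> m l g)"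
    using assms(8,9) by (auto simp: generates_code_def)
  then have "SE.act (f G) y = 0"
    using G_up g_up assms(11,12)
    by (intro SE.act_eq_zero_of_left_multiple[of "f G" "f g" y "R_ideal F \<theta> m l"])
      (auto simp: nu_def R_ring_def R_class_def R_ideal_def skew_S_def f_def[symmetric]
        G_def[symmetric] act_f[of "Polynomial.degree g"] coeff_eq_0)
  moreover have "SE.act (f G) y = (\<Sum>j\<le>m - 1. poly (poly.coeff G j) a * (\<sigma> ^^ j) y)"
    using assms(3) by (intro act_f) (auto simp: coeffG)
  moreover have "{..m - 1} = {..<m}" using assms(3) by auto
  ultimately show ?thesis
    by (simp add: coeffG poly_sum poly_monom sum_distrib_right mult.assoc)
qed

section \<open>Galois groups and normal elements\<close>

lemma ring_iso_subfield_iff: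
  fixes L :: "'a::field set"
  assumes "f \<in> Bij L"
  shows "f \<in> ring_iso (\<Omega>\<lparr>carrier := L\<rparr>) (\<Omega>\<lparr>carrier := L\<rparr>) \<longleftrightarrow>
    (\<forall>x\<in>L. \<forall>y\<in>L. f (x + y) = f x + f y \<and> f (x * y) = f x * f y) \<and> f 1 = 1"
  using assms by (auto simp: ring_iso_def Ring.ring_hom_def Bij_def ring_of_type_algebra_def bij_betw_def)

text \<open>\<open>galois_group\<close> merely restricts the carrier of \<open>BijGroup L\<close>;
  the group laws are needed for integer powers and for the order of \<open>\<theta>\<close>.\<close>

lemma group_galois_group:
  fixes L K :: "'a::field set"
  assumes "subfield L \<Omega>" "K \<subseteq> L"
  shows "group (galois_group L K)"
proof -
  interpret ambient_subfield L by (rule ambient_subfield.intro[OF assms(1)])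
  interpret B: group "BijGroup L" by (rule group_BijGroup)
  define H where "H = {\<tau> \<in> Bij L. \<tau> \<in> ring_iso (\<Omega>\<lparr>carrier := L\<rparr>) (\<Omega>\<lparr>carrier := L\<rparr>) \<and> (\<forall>x\<in>K. \<tau> x = x)}"
  have H: "f \<in> H \<longleftrightarrow> f \<in> Bij L \<and>
      (\<forall>x\<in>L. \<forall>y\<in>L. f (x + y) = f x + f y \<and> f (x * y) = f x * f y) \<and> f 1 = 1 \<and> (\<forall>x\<in>K. f x = x)" for f
    using ring_iso_subfield_iff[of f L] by (auto simp: H_def)
  have "subgroup H (BijGroup L)"
  proof (rule B.subgroupI)
    show "H \<subseteq> carrier (BijGroup L)" using H by (auto simp: BijGroup_def)
    have "(\<lambda>x\<in>L. x) \<in> H" using assms(2) by (auto simp: H id_Bij)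
    then show "H \<noteq> {}" by blast
  next
    fix f assume f: "f \<in> H"
    then have fB: "f \<in> Bij L" and f1: "f 1 = 1" and fK: "\<forall>x\<in>K. f x = x" by (simp_all add: H)
    have inv_of: "inv_into L f (f x) = x" if "x \<in> L" for x
      using fB that by (simp add: Bij_def bij_betw_def)
    have inv_add: "inv_into L f (x + y) = inv_into L f x + inv_into L f y"
      and inv_mult: "inv_into L f (x * y) = inv_into L f x * inv_into L f y" if "x \<in> L" "y \<in> L" for x y
      using f that fB
      by (auto intro!: Bij_inv_into_lemma[where S = L] simp: H)
    have "inv_into L f 1 = 1" using inv_of[of 1] f1 by simp
    moreover have "inv_into L f x = x" if "x \<in> K" for x using inv_of[of x] fK that assms(2) by auto
    ultimately have "(\<lambda>x\<in>L. inv_into L f x) \<in> H"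
      using restrict_inv_into_Bij[OF fB] inv_add inv_mult assms(2) by (auto simp: H)
    then show "inv\<^bsub>BijGroup L\<^esub> f \<in> H" using fB by (simp add: inv_BijGroup)
  next
    fix f g assume fg: "f \<in> H" "g \<in> H"
    then have B: "f \<in> Bij L" "g \<in> Bij L" by (simp_all add: H)
    have gL: "g x \<in> L" if "x \<in> L" for x using Bij_imp_funcset[OF B(2)] that by auto
    have "compose L f g \<in> H"
      using fg gL compose_Bij[OF B] assms(2) by (auto simp: H compose_def subset_iff)
    then show "f \<otimes>\<^bsub>BijGroup L\<^esub> g \<in> H" using B by (simp add: BijGroup_def)
  qed
  then have "group ((BijGroup L)\<lparr>carrier := H\<rparr>)" by (rule B.subgroup_imp_group)
  then show ?thesis by (simp add: galois_group_def H_def)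
qed

lemma galois_group_memD:
  fixes L K :: "'a::field set"
  assumes "subfield L \<Omega>" "\<sigma> \<in> carrier (galois_group L K)"
  shows "subfield_endomorphism L \<sigma>" "\<And>x. x \<in> K \<Longrightarrow> \<sigma> x = x"
proof -
  interpret ambient_subfield L by (rule ambient_subfield.intro[OF assms(1)])
  have s: "\<sigma> \<in> Bij L" "\<sigma> \<in> ring_iso (\<Omega>\<lparr>carrier := L\<rparr>) (\<Omega>\<lparr>carrier := L\<rparr>)" "\<And>x. x \<in> K \<Longrightarrow> \<sigma> x = x"
    using assms(2) by (auto simp: galois_group_def)
  show "\<And>x. x \<in> K \<Longrightarrow> \<sigma> x = x" by fact
  show "subfield_endomorphism L \<sigma>"
    using ring_iso_memE[OF s(2)] by unfold_locales (auto simp: ring_of_type_algebra_def)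
qed

lemma galois_group_pow:
  fixes L K :: "'a::field set" and i :: nat
  assumes "subfield L \<Omega>" "\<sigma> \<in> carrier (galois_group L K)" "x \<in> L" "K \<subseteq> L"
  shows "(\<sigma> [^]\<^bsub>galois_group L K\<^esub> i) x = (\<sigma> ^^ i) x"
  using assms(3)
proof (induction i arbitrary: x)
  case 0
  then show ?case by (simp add: galois_group_def BijGroup_def)
next
  case (Suc i)
  interpret G: group "galois_group L K" by (rule group_galois_group[OF assms(1,4)])
  interpret subfield_endomorphism L \<sigma> by (rule galois_group_memD[OF assms(1,2)])
  have bij: "\<tau> \<in> Bij L" if "\<tau> \<in> carrier (galois_group L K)" for \<tau>
    using that by (simp add: galois_group_def)
  have "\<sigma> [^]\<^bsub>galois_group L K\<^esub> Suc i =
      compose L (\<sigma> [^]\<^bsub>galois_group L K\<^esub> i) \<sigma>"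
    using bij[OF assms(2)] bij[OF G.nat_pow_closed[OF assms(2)], of i]
    by (simp add: galois_group_def BijGroup_def)
  then show ?case using Suc by (simp add: compose_def funpow_swap1)
qed

text \<open>Allows integer exponents to be replaced by natural ones. That the \<open>m\<close>-th
  power is the unit is an equality of functions, hence the appeal to extensionality outside
  \<open>L\<close>.\<close>

lemma galois_group_int_pow_cong:
  fixes L K :: "'a::field set" and e :: int and i m :: nat
  assumes "subfield L \<Omega>" "\<sigma> \<in> carrier (galois_group L K)" "x \<in> L" "K \<subseteq> L"
    and "\<And>y. y \<in> L \<Longrightarrow> (\<sigma> ^^ m) y = y" "[e = int i] (mod int m)"
  shows "(\<sigma> [^]\<^bsub>galois_group L K\<^esub> e) x = (\<sigma> ^^ i) x"
proof -
  interpret G: group "galois_group L K" by (rule group_galois_group[OF assms(1,4)])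
  let ?G = "galois_group L K"
  have "\<sigma> [^]\<^bsub>?G\<^esub> m = \<one>\<^bsub>?G\<^esub>"
  proof (rule extensionalityI)
    show "\<sigma> [^]\<^bsub>?G\<^esub> m \<in> extensional L"
      using G.nat_pow_closed[OF assms(2), of m] by (auto simp: galois_group_def Bij_def)
    show "\<one>\<^bsub>?G\<^esub> \<in> extensional L" by (simp add: galois_group_def BijGroup_def)
    show "(\<sigma> [^]\<^bsub>?G\<^esub> m) y = \<one>\<^bsub>?G\<^esub> y" if "y \<in> L" for y
      using that assms(5) galois_group_pow[OF assms(1,2) that assms(4)]
      by (simp add: galois_group_def BijGroup_def)
  qed
  moreover obtain q where "e = int i + int m * q"
    using assms(6) by (metis cong_iff_lin cong_sym)
  ultimately have "\<sigma> [^]\<^bsub>?G\<^esub> e = \<sigma> [^]\<^bsub>?G\<^esub> i"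
    using assms(2) by (simp add: G.int_pow_mult G.int_pow_pow[symmetric] int_pow_int)
  then show ?thesis using galois_group_pow[OF assms(1-4)] by simp
qed

section \<open>Independence, span and dimension expressed through finite sums\<close>

lemma combine_map:
  fixes x v :: "'i \<Rightarrow> 'a::field"
  shows "ring.combine \<Omega> (map x is) (map v is) = (\<Sum>i\<leftarrow>is. x i * v i)"
proof -
  interpret R: field "\<Omega> :: 'a ring" by (rule field_from_type_algebra)
  show ?thesis by (induction "is") auto
qed

lemma independent_map_iff:
  fixes v :: "'i \<Rightarrow> 'a::field"
  assumes "subfield K \<Omega>" "distinct is"
  shows "ring.independent \<Omega> K (map v is) \<longleftrightarrow>
    (\<forall>x. (\<forall>i\<in>set is. x i \<in> K) \<longrightarrow> (\<Sum>i\<in>set is. x i * v i) = 0 \<longrightarrow> (\<forall>i\<in>set is. x i = 0))"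
proof -
  interpret R: field "\<Omega> :: 'a ring" by (rule field_from_type_algebra)
  have sum: "R.combine (map x is) (map v is) = (\<Sum>i\<in>set is. x i * v i)" for x
    using assms(2) by (simp add: combine_map sum_list_distinct_conv_sum_set)
  show ?thesis
  proof (intro iffI allI impI)
    fix x assume *: "R.independent K (map v is)" "\<forall>i\<in>set is. x i \<in> K"
      "(\<Sum>i\<in>set is. x i * v i) = 0"
    have "set (take (length (map v is)) (map x is)) \<subseteq> {\<zero>\<^bsub>\<Omega>\<^esub>}"
      using * sum[of x]
      by (intro R.independent_imp_trivial_combine[OF assms(1)]) auto
    then show "\<forall>i\<in>set is. x i = 0" by auto
  next
    assume *: "\<forall>x. (\<forall>i\<in>set is. x i \<in> K) \<longrightarrow> (\<Sum>i\<in>set is. x i * v i) = 0 \<longrightarrow> (\<forall>i\<in>set is. x i = 0)"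
    show "R.independent K (map v is)"
    proof (rule R.trivial_combine_imp_independent[OF assms(1)])
      fix Ks assume Ks: "set Ks \<subseteq> K" "R.combine Ks (map v is) = \<zero>\<^bsub>\<Omega>\<^esub>"
      \<comment> \<open>\<open>combine\<close> stops at the end of the shorter list, so the
        coefficients are first brought to the right length and can then be read as a function of the
        index.\<close>
      obtain Ks' where Ks': "set (take (length (map v is)) Ks) \<subseteq> set Ks'"
        "set Ks' \<subseteq> set (take (length (map v is)) Ks) \<union> {\<zero>\<^bsub>\<Omega>\<^esub>}"
        "length Ks' = length (map v is)" "R.combine Ks' (map v is) = \<zero>\<^bsub>\<Omega>\<^esub>"
        by (rule R.combine_normalize[OF _ _ Ks(2)]) auto
      define x where "x = the \<circ> map_of (zip is Ks')"
      have "map x is = Ks'"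
        using assms(2) Ks'(3) by (intro nth_equalityI) (auto simp: x_def map_of_zip_nth)
      moreover have "set Ks' \<subseteq> K"
        using Ks'(2) Ks(1) subfield_ambient_closed(1)[OF assms(1)] by (auto dest: in_set_takeD)
      ultimately have "\<forall>i\<in>set is. x i = 0"
        using *[THEN spec[of _ x]] sum[of x] Ks'(4) by auto
      then show "set (take (length (map v is)) Ks) \<subseteq> {\<zero>\<^bsub>\<Omega>\<^esub>}"
        using Ks'(1) \<open>map x is = Ks'\<close> by auto
    qed simp
  qed
qed

lemma Span_map_eq:
  fixes v :: "'i \<Rightarrow> 'a::field"
  assumes "subfield K \<Omega>" "distinct is"
  shows "ring.Span \<Omega> K (map v is) = {\<Sum>i\<in>set is. x i * v i | x. \<forall>i\<in>set is. x i \<in> K}"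
proof -
  interpret R: field "\<Omega> :: 'a ring" by (rule field_from_type_algebra)
  have sum: "R.combine (map x is) (map v is) = (\<Sum>i\<in>set is. x i * v i)" for x
    using assms(2) by (simp add: combine_map sum_list_distinct_conv_sum_set)
  have "R.Span K (map v is) = {R.combine Ks (map v is) | Ks. length Ks = length is \<and> set Ks \<subseteq> K}"
    using R.Span_eq_combine_set_length_version[OF assms(1), of "map v is"] by simp
  also have "\<dots> = {R.combine (map x is) (map v is) | x. \<forall>i\<in>set is. x i \<in> K}"
  proof (intro Collect_cong iffI; elim exE conjE)
    fix y Ks assume Ks: "y = R.combine Ks (map v is)" "length Ks = length is" "set Ks \<subseteq> K"
    define x where "x = the \<circ> map_of (zip is Ks)"
    have x: "map x is = Ks"
      using assms(2) Ks(2) by (intro nth_equalityI) (auto simp: x_def map_of_zip_nth)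
    then have "x ` set is \<subseteq> K" using Ks(3) by (metis set_map)
    then show "\<exists>x. y = R.combine (map x is) (map v is) \<and> (\<forall>i\<in>set is. x i \<in> K)"
      using Ks(1) x by (intro exI[of _ x]) auto
  next
    fix y x assume "y = R.combine (map x is) (map v is)" "\<forall>i\<in>set is. x i \<in> K"
    then show "\<exists>Ks. y = R.combine Ks (map v is) \<and> length Ks = length is \<and> set Ks \<subseteq> K"
      by (intro exI[of _ "map x is"]) auto
  qed
  finally show ?thesis by (simp add: sum)
qed

lemma dim_Span_eq_card:
  fixes v :: "nat \<Rightarrow> 'a::field"
  assumes "subfield E \<Omega>" "B \<subseteq> {..<m}" "\<And>u j. A u j \<in> E"
    and "\<And>j. j < m \<Longrightarrow> v j = (\<Sum>u\<in>B. A u j * v u)"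
    and "\<And>c. (\<And>u. u \<in> B \<Longrightarrow> c u \<in> E) \<Longrightarrow> (\<Sum>u\<in>B. c u * v u) = 0 \<Longrightarrow> \<forall>u\<in>B. c u = 0"
  shows "ring.dim \<Omega> E (ring.Span \<Omega> E (map v [0..<m])) = card B"
proof -
  interpret R: field "\<Omega> :: 'a ring" by (rule field_from_type_algebra)
  have fB: "finite B" using assms(2) finite_subset by blast
  define bs where "bs = sorted_list_of_set B"
  have bs: "set bs = B" "distinct bs" "length bs = card B" using fB by (simp_all add: bs_def)
  have "R.independent E (map v bs)"
    unfolding independent_map_iff[OF assms(1) bs(2)] bs(1)
  proof (intro allI impI)
    fix c assume c: "\<forall>u\<in>B. c u \<in> E" "(\<Sum>u\<in>B. c u * v u) = 0"
    show "\<forall>u\<in>B. c u = 0" by (rule assms(5)[OF c(1)[rule_format] c(2)])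
  qed
  then have "R.dimension (card B) E (R.Span E (map v bs))"
    using R.dimension_independent[of E "map v bs"] bs(3) by simp
  moreover have "R.Span E (map v bs) = R.Span E (map v [0..<m])"
  proof
    show "R.Span E (map v bs) \<subseteq> R.Span E (map v [0..<m])"
      using assms(2) bs(1) by (intro R.mono_Span_sublist[OF assms(1)]) auto
    show "R.Span E (map v [0..<m]) \<subseteq> R.Span E (map v bs)"
    proof (rule R.mono_Span_subset[OF assms(1)])
      show "set (map v [0..<m]) \<subseteq> R.Span E (map v bs)"
        unfolding Span_map_eq[OF assms(1) bs(2)] bs(1)
      proof
        fix y assume "y \<in> set (map v [0..<m])"
        then obtain j where "j < m" "y = v j" by auto
        then have "y = (\<Sum>u\<in>B. A u j * v u)" using assms(4) by metis
        then show "y \<in> {\<Sum>i\<in>B. x i * v i |x. \<forall>i\<in>B. x i \<in> E}"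
          using assms(3) by (intro CollectI exI[of _ "\<lambda>u. A u j"]) simp
      qed
    qed simp
  qed
  ultimately show ?thesis
    unfolding R.dim_def using R.dimension_is_inj[OF assms(1)] by (intro the_equality) auto
qed

section \<open>Normal bases, fixed fields and linear disjointness\<close>

lemma normal_element_independent:
  assumes "normal_element K L \<sigma> m \<beta>" "subfield K \<Omega>"
    and "\<And>j. j < m \<Longrightarrow> x j \<in> K" "(\<Sum>j<m. x j * (\<sigma> ^^ j) \<beta>) = 0" "j < m"
  shows "x j = 0"
proof -
  have "\<forall>i\<in>set [0..<m]. x i = 0"
    using assms(1) assms(3,4)
    unfolding normal_element_def independent_map_iff[OF assms(2) distinct_upt]
    by (auto simp: atLeast0LessThan)
  then show ?thesis using assms(5) by simp
qed

lemma normal_element_expansion: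
  assumes "normal_element K L \<sigma> m \<beta>" "subfield K \<Omega>" "y \<in> L"
  obtains x where "\<And>j. j < m \<Longrightarrow> x j \<in> K" "y = (\<Sum>j<m. x j * (\<sigma> ^^ j) \<beta>)"
proof -
  have "y \<in> {\<Sum>i\<in>set [0..<m]. x i * (\<sigma> ^^ i) \<beta> | x. \<forall>i\<in>set [0..<m]. x i \<in> K}"
    using assms(1,3) unfolding normal_element_def Span_map_eq[OF assms(2) distinct_upt] by simp
  then show thesis using that by (auto simp: atLeast0LessThan)
qed

text \<open>A fixed point has constant coordinates with respect to a normal basis, so it is a multiple
  by an element of \<open>K\<close> of the trace of \<open>\<beta>\<close>, as is \<open>1\<close>.\<close>

lemma subfield_automorphism_of_normal_element:
  assumes "subfield_endomorphism L \<sigma>" "\<And>x. x \<in> K \<Longrightarrow> \<sigma> x = x" "K \<subseteq> L" "subfield K \<Omega>"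
    and "\<And>x. x \<in> L \<Longrightarrow> (\<sigma> ^^ m) x = x" "normal_element K L \<sigma> m \<beta>" "m > 0"
  shows "subfield_automorphism L K \<sigma> m"
proof -
  interpret S: subfield_endomorphism L \<sigma> by fact
  interpret K: ambient_subfield K by (rule ambient_subfield.intro[OF assms(4)])
  have \<beta>L: "\<beta> \<in> L" using assms(6) by (simp add: normal_element_def)
  have fixed: "\<exists>t\<in>K. x = t * (\<Sum>j<m. (\<sigma> ^^ j) \<beta>)" if x: "x \<in> L" "\<sigma> x = x" for x
  proof -
    obtain y where y: "\<And>j. j < m \<Longrightarrow> y j \<in> K" "x = (\<Sum>j<m. y j * (\<sigma> ^^ j) \<beta>)"
      using normal_element_expansion[OF assms(6,4) x(1)] by blast
    have yL: "y j \<in> L" if "j < m" for j using y(1)[OF that] assms(3) by auto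
    obtain m' where m': "m = Suc m'" using assms(7) by (cases m) auto
    have "x = (\<Sum>j<m. \<sigma> (y j * (\<sigma> ^^ j) \<beta>))"
      using x(2) yL \<beta>L unfolding y(2) by (subst (asm) S.hom_sum) auto
    also have "\<dots> = (\<Sum>j<m. y j * (\<sigma> ^^ Suc j) \<beta>)"
      using yL \<beta>L y(1) assms(2) by (intro sum.cong) (auto simp: S.hom_mult)
    also have "\<dots> = y m' * (\<sigma> ^^ m) \<beta> + (\<Sum>j<m'. y j * (\<sigma> ^^ Suc j) \<beta>)"
      by (simp add: m')
    \<comment> \<open>\<open>\<sigma>\<close> permutes the normal basis cyclically: the top
      conjugate \<open>(\<sigma> ^^ m) \<beta>\<close> wraps around to \<open>\<beta>\<close>, so
      the coordinates move by one place.\<close>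
    also have "\<dots> = (\<Sum>j<m. y (if j = 0 then m' else j - 1) * (\<sigma> ^^ j) \<beta>)"
      using assms(5)[OF \<beta>L] unfolding m' sum.lessThan_Suc_shift by simp
    finally have "(\<Sum>j<m. (y j - y (if j = 0 then m' else j - 1)) * (\<sigma> ^^ j) \<beta>) = 0"
      using y(2) by (simp add: sum_subtractf left_diff_distrib)
    then have step: "y j - y (if j = 0 then m' else j - 1) = 0" if "j < m" for j
      using that y(1) m'
      by (intro normal_element_independent[OF assms(6,4),
            where x = "\<lambda>j. y j - y (if j = 0 then m' else j - 1)"]) auto
    have const: "y j = y 0" if "j < m" for j
      using that
    proof (induction j)
      case (Suc j)
      then show ?case using step[of "Suc j"] by simp
    qed simp
    have "x = y 0 * (\<Sum>j<m. (\<sigma> ^^ j) \<beta>)"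
      unfolding y(2) sum_distrib_left by (intro sum.cong refl, subst const) auto
    then show ?thesis using y(1)[of 0] assms(7) by blast
  qed
  obtain t where t: "t \<in> K" "1 = t * (\<Sum>j<m. (\<sigma> ^^ j) \<beta>)"
    using fixed[of 1] S.hom_one by auto
  have "x \<in> K" if "x \<in> L" "\<sigma> x = x" for x
  proof -
    obtain u where u: "u \<in> K" "x = u * (\<Sum>j<m. (\<sigma> ^^ j) \<beta>)" using fixed \<open>x \<in> L\<close> \<open>\<sigma> x = x\<close> by blast
    \<comment> \<open>Dividing the two multiples of the trace eliminates it: the trace is
      \<open>1 / t\<close>, hence \<open>x = u / t\<close>.\<close>
    have "t \<noteq> 0" using t(2) by auto
    have "x * t = u * (t * (\<Sum>j<m. (\<sigma> ^^ j) \<beta>))" unfolding u(2) by (simp only: mult_ac)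
    then have "x = u / t" using t(2) \<open>t \<noteq> 0\<close> by (simp add: nonzero_eq_divide_eq)
    then show ?thesis using u(1) t(1) by simp
  qed
  then show ?thesis
    using assms(2,3,5) by unfold_locales auto
qed

text \<open>A combination with coefficients in \<open>F\<close> of the conjugates
  \<open>\<theta> ^^ i (v u)\<close> that vanishes for all \<open>u\<close> but \<open>u0\<close> isolates the coefficient \<open>c u0\<close>, because
  \<open>\<sigma>\<close> extends \<open>\<theta>\<close> and fixes \<open>K\<close>.\<close>

lemma linearly_disjoint:
  fixes F K L :: "'a::field set" and v c :: "'i \<Rightarrow> 'a"
  assumes "subfield_automorphism L K \<sigma> m" "subfield_automorphism F E \<theta> m"
    and "F \<subseteq> L" "\<And>x. x \<in> F \<Longrightarrow> \<theta> x = \<sigma> x"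
    and "finite B" "\<And>u. u \<in> B \<Longrightarrow> v u \<in> F"
    and "\<And>c. (\<And>u. u \<in> B \<Longrightarrow> c u \<in> E) \<Longrightarrow> (\<Sum>u\<in>B. c u * v u) = 0 \<Longrightarrow> \<forall>u\<in>B. c u = 0"
    and "\<And>u. u \<in> B \<Longrightarrow> c u \<in> K" "(\<Sum>u\<in>B. c u * v u) = 0" "u0 \<in> B"
  shows "c u0 = 0"
proof -
  interpret S: subfield_automorphism L K \<sigma> m by fact
  interpret T: subfield_automorphism F E \<theta> m by fact
  have pow: "(\<theta> ^^ i) x = (\<sigma> ^^ i) x" if "x \<in> F" for x i
  proof (induction i)
    case (Suc i)
    have "\<theta> ((\<theta> ^^ i) x) = \<sigma> ((\<theta> ^^ i) x)" using that by (intro assms(4)) simp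
    then show ?case using Suc by simp
  qed simp
  have "card (B - {u0}) < card {..<card B}"
    using card_Diff1_less[OF assms(5,10)] by simp
  \<comment> \<open>Coefficients of the combination announced above: \<open>card B - 1\<close>
    conditions, one for each index other than \<open>u0\<close>, on \<open>card B\<close>
    unknowns.\<close>
  then obtain q where q: "\<And>i. i \<in> {..<card B} \<Longrightarrow> q i \<in> F" "\<exists>i\<in>{..<card B}. q i \<noteq> 0"
    "\<And>u. u \<in> B - {u0} \<Longrightarrow> (\<Sum>i<card B. (\<theta> ^^ i) (v u) * q i) = 0"
    by (rule T.homogeneous_system_solution[of "B - {u0}" "{..<card B}" "\<lambda>u i. (\<theta> ^^ i) (v u)",
          rotated 2]) (use assms(5,6) in auto)
  define w where "w u = (\<Sum>i<card B. q i * (\<theta> ^^ i) (v u))" for u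
  have w0: "w u0 \<noteq> 0"
  proof
    assume "w u0 = 0"
    then have w: "w u = 0" if "u \<in> B" for u
      using q(3) that by (cases "u = u0") (auto simp: w_def mult.commute)
    \<comment> \<open>A single class with scalar 1, that is, the classical Moore matrix of a family
      independent over \<open>E\<close>.\<close>
    have "classwise_independent E B (\<lambda>_. ()) v"
      unfolding classwise_independent_def
    proof (intro allI impI)
      fix x :: "'i \<Rightarrow> 'a" and t
      assume x: "\<forall>u\<in>B. x u \<in> E" "(\<Sum>u | u \<in> B \<and> () = t. x u * v u) = 0"
      have "(\<Sum>u\<in>B. x u * v u) = 0" using x(2) by simp
      note assms(7)[OF x(1)[rule_format] this]
      then show "\<forall>u\<in>B. () = t \<longrightarrow> x u = 0" by simp
    qed
    then have "\<forall>i<card B. q i = 0"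
      using assms(5,6) q(1) w
      by (intro T.moore_rows_independent[of B "\<lambda>_. ()" v "\<lambda>_. 1"]) (auto simp: w_def)
    then show False using q(2) by auto
  qed
  have vL: "v u \<in> L" if "u \<in> B" for u using assms(3,6) that by auto
  \<comment> \<open>Each \<open>\<sigma> ^^ i\<close> fixes the \<open>c u\<close>, so the given
    relation holds for all conjugates of the \<open>v u\<close>; weighting these with
    \<open>q\<close> leaves only the term at \<open>u0\<close>.\<close>
  have "(\<Sum>u\<in>B. c u * w u) = (\<Sum>i<card B. q i * (\<Sum>u\<in>B. c u * (\<sigma> ^^ i) (v u)))"
  proof -
    have "(\<Sum>u\<in>B. c u * w u) = (\<Sum>u\<in>B. \<Sum>i<card B. q i * (c u * (\<sigma> ^^ i) (v u)))"
      using assms(6) by (intro sum.cong) (auto simp: w_def sum_distrib_left pow mult_ac)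
    then show ?thesis by (subst (asm) sum.swap) (simp add: sum_distrib_left)
  qed
  also have "\<dots> = (\<Sum>i<card B. q i * (\<sigma> ^^ i) (\<Sum>u\<in>B. c u * v u))"
    using assms(8) vL by (intro sum.cong refl, subst S.funpow_sum) (auto simp: S.iterate_mult)
  finally have "(\<Sum>u\<in>B. c u * w u) = 0" using assms(9) by simp
  moreover have "(\<Sum>u\<in>B. c u * w u) = c u0 * w u0"
    using assms(5,10) q(3) by (subst sum.remove[of _ u0]) (auto simp: w_def mult.commute)
  ultimately show ?thesis using w0 by simp
qed

section \<open>The weight of a codeword\<close>

lemma power_int_eq_power_of_cong:
  fixes a :: "'a::field"
  assumes "a ^ l = 1" "l > 0" "[e = int i] (mod int l)"
  shows "a powi e = a ^ i"
proof -
  have "a \<noteq> 0" using assms(1,2) by (auto simp: zero_power)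
  obtain q where "e = int i + int l * q" using assms(3) by (metis cong_iff_lin cong_sym)
  then show ?thesis using assms(1) \<open>a \<noteq> 0\<close> by (simp add: power_int_add power_int_mult)
qed

text \<open>The points fixed by an iterate are closed under the field operations, so it suffices to
  check generators: on \<open>F\<close> the order of \<open>\<theta>\<close> decides, on
  \<open>K\<close> the map is trivial.\<close>

lemma iterate_period_generate_field:
  fixes F K :: "'a::field set"
  assumes "subfield_endomorphism L \<sigma>" "L = generate_field \<Omega> (F \<union> K)"
    and "\<And>x. x \<in> F \<union> K \<Longrightarrow> (\<sigma> ^^ m) x = x" "x \<in> L"
  shows "(\<sigma> ^^ m) x = x"
proof -
  interpret subfield_endomorphism L \<sigma> by fact
  have "x \<in> generate_field \<Omega> (F \<union> K)" using assms(2,4) by simp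
  then show ?thesis
  proof (induction rule: generate_field.induct)
    case one
    show ?case by (simp add: funpow_one)
  next
    case (incl x)
    then show ?case by (rule assms(3))
  next
    case (a_inv x)
    then show ?case using assms(2) by (simp add: iterate_minus)
  next
    case (m_inv x)
    then show ?case using assms(2) by (simp add: iterate_inverse)
  next
    case (eng_add x y)
    then show ?case using assms(2) by (simp add: iterate_add)
  next
    case (eng_mult x y)
    then show ?case using assms(2) by (simp add: iterate_mult)
  qed
qed

text \<open>The basis of the span of a block is taken among its entries, so that the coefficient matrix
  contains an identity matrix and \<open>\<gamma>\<close> inherits independence from the normal basis.\<close>

lemma wt_srk_ge:
  fixes E F K L :: "'a::field set" and c :: "'a vec" and k :: "nat \<Rightarrow> nat"
  assumes "subfield_automorphism L K \<sigma> m" "subfield_automorphism F E \<theta> m" "subfield E \<Omega>"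
    and "subfield K \<Omega>" "F \<subseteq> L" "E \<subseteq> K" "\<And>x. x \<in> F \<Longrightarrow> \<theta> x = \<sigma> x"
    and "normal_element K L \<sigma> m \<beta>" "a \<in> K" "primitive_root_of_unity l a"
    and "m > 0" "coprime s m" "coprime s l" "coprime m l"
    and "\<And>i j. i < j \<Longrightarrow> j \<le> r \<Longrightarrow> k i < k j" "k r + 2 \<le> k 0 + d + r"
    and "\<And>i j. i < l \<Longrightarrow> j < m \<Longrightarrow> entry m c i j \<in> F" "i0 < l" "j0 < m" "entry m c i0 j0 \<noteq> 0"
    and "\<And>i j. i < d - 1 \<Longrightarrow> j \<le> r \<Longrightarrow>
      (\<Sum>u<m. \<Sum>t<l. entry m c t u * (a ^ (b + (s * i + k j))) ^ t *
        (\<sigma> ^^ u) ((\<sigma> ^^ (s * i + k j)) \<beta>)) = 0"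
  shows "d + r \<le> wt_srk E m l c"
proof -
  interpret S: subfield_automorphism L K \<sigma> m by fact
  interpret T: subfield_automorphism F E \<theta> m by fact
  interpret E: ambient_subfield E by (rule ambient_subfield.intro[OF assms(3)])
  interpret K: ambient_subfield K by (rule ambient_subfield.intro[OF assms(4)])
  have \<beta>L: "\<beta> \<in> L" using assms(8) by (simp add: normal_element_def)
  have a0: "a \<noteq> 0" using assms(10,18) by (auto simp: primitive_root_of_unity_def zero_power)
  define basis where "basis t B A \<longleftrightarrow> B \<subseteq> {..<m} \<and> (\<forall>u j. A u j \<in> E) \<and>
    (\<forall>u\<in>B. \<forall>j\<in>B. A u j = (if u = j then 1 else 0)) \<and>
    (\<forall>j<m. entry m c t j = (\<Sum>u\<in>B. A u j * entry m c t u)) \<and>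
    (\<forall>x. (\<forall>u\<in>B. x u \<in> E) \<longrightarrow> (\<Sum>u\<in>B. x u * entry m c t u) = 0 \<longrightarrow> (\<forall>u\<in>B. x u = 0))"
    for t and B :: "nat set" and A :: "nat \<Rightarrow> nat \<Rightarrow> 'a"
  have "\<forall>t. \<exists>B A. basis t B A"
    unfolding basis_def by (rule allI, rule E.ex_basis_subfamily)
  then obtain B A where "\<forall>t. basis t (B t) (A t)" by metis
  then have basis: "basis t (B t) (A t)" for t by blast
  have B: "B t \<subseteq> {..<m}" and AE: "A t u j \<in> E"
    and Adelta: "u \<in> B t \<Longrightarrow> j \<in> B t \<Longrightarrow> A t u j = (if u = j then 1 else 0)"
    and expand: "j < m \<Longrightarrow> entry m c t j = (\<Sum>u\<in>B t. A t u j * entry m c t u)" for t u j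
    using basis[of t, unfolded basis_def] by (elim conjE; blast)+
  have indep: "\<forall>u\<in>B t. x u = 0"
    if "\<And>u. u \<in> B t \<Longrightarrow> x u \<in> E" "(\<Sum>u\<in>B t. x u * entry m c t u) = 0" for t and x
    using basis[of t, unfolded basis_def, THEN conjunct2, THEN conjunct2, THEN conjunct2,
        THEN conjunct2, THEN spec[of _ x]] that by simp
  have fB: "finite (B t)" for t using B finite_subset by blast
  have entryF: "entry m c t u \<in> F" if "t < l" "u \<in> B t" for t u using assms(17) B that by auto
  have AK: "A t u j \<in> K" for t u j using AE assms(6) by auto
  define P where "P = (SIGMA t:{..<l}. B t)"
  define \<gamma> where "\<gamma> p = (\<Sum>j<m. A (fst p) (snd p) j * (\<sigma> ^^ j) \<beta>)" for p
  \<comment> \<open>The factor \<open>a ^ (b * t)\<close> absorbs the offset \<open>b\<close>, so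
    that afterwards the same exponent governs \<open>a\<close> and \<open>\<sigma>\<close>.\<close>
  define Y where "Y p = entry m c (fst p) (snd p) * a ^ (b * fst p)" for p
  have fP: "finite P" unfolding P_def using fB by auto
  have "P \<noteq> {}"
  proof
    assume "P = {}"
    then have "B i0 = {}" using assms(18) by (auto simp: P_def)
    then show False using expand[of j0 i0] assms(19,20) by simp
  qed
  have class_sum: "(\<Sum>p | p \<in> P \<and> fst p = t. f p) = (\<Sum>u\<in>B t. f (t, u))"
    if "t < l" for f :: "nat \<times> nat \<Rightarrow> 'a" and t
    by (rule sum.reindex_bij_witness[of _ "\<lambda>u. (t, u)" snd]) (use that in \<open>auto simp: P_def\<close>)
  have \<gamma>L: "\<gamma> p \<in> L" for p unfolding \<gamma>_def using \<beta>L AK by (intro S.sum_closed) simp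
  have \<gamma>_indep: "classwise_independent K P fst \<gamma>"
    unfolding classwise_independent_def
  proof (intro allI impI ballI)
    fix x t p
    assume x: "\<forall>p\<in>P. x p \<in> K" "(\<Sum>p | p \<in> P \<and> fst p = t. x p * \<gamma> p) = 0" "p \<in> P" "fst p = t"
    then obtain u where u: "p = (t, u)" "t < l" "u \<in> B t" by (auto simp: P_def)
    \<comment> \<open>The coordinates of the relation in the normal basis. At an index of
      \<open>B t\<close> the identity block of \<open>A\<close> singles out one coefficient of
      \<open>x\<close>.\<close>
    define y where "y j = (\<Sum>u\<in>B t. x (t, u) * A t u j)" for j
    have xK: "x (t, u) \<in> K" if "u \<in> B t" for u using x(1) that u(2) by (auto simp: P_def)
    have "(\<Sum>j<m. y j * (\<sigma> ^^ j) \<beta>) = (\<Sum>u\<in>B t. x (t, u) * \<gamma> (t, u))"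
      unfolding y_def \<gamma>_def sum_distrib_left sum_distrib_right
      by (subst sum.swap) (simp add: mult.assoc)
    also have "\<dots> = 0" using x(2) class_sum[OF u(2), of "\<lambda>p. x p * \<gamma> p"] by simp
    finally have "y u = 0"
      using B u(3) xK AK
      by (intro normal_element_independent[OF assms(8,4), where x = y]) (auto simp: y_def)
    moreover have "y u = (\<Sum>u'\<in>B t. if u' = u then x (t, u) else 0)"
      unfolding y_def using Adelta u(3) by (intro sum.cong) auto
    ultimately show "x p = 0" using fB u(1,3) by simp
  qed
  have Y_indep: "classwise_independent K P fst Y"
    unfolding classwise_independent_def
  proof (intro allI impI ballI)
    fix x t p
    assume x: "\<forall>p\<in>P. x p \<in> K" "(\<Sum>p | p \<in> P \<and> fst p = t. x p * Y p) = 0" "p \<in> P" "fst p = t"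
    then obtain u where u: "p = (t, u)" "t < l" "u \<in> B t" by (auto simp: P_def)
    have "(\<Sum>u\<in>B t. x (t, u) * entry m c t u) * a ^ (b * t) = (\<Sum>u\<in>B t. x (t, u) * Y (t, u))"
      by (simp add: Y_def sum_distrib_right mult.assoc)
    also have "\<dots> = 0" using x(2) class_sum[OF u(2), of "\<lambda>p. x p * Y p"] by simp
    finally have "(\<Sum>u\<in>B t. x (t, u) * entry m c t u) = 0" using a0 by simp
    then have "x (t, u) = 0"
      using fB u x(1) entryF indep[of t]
      by (intro linearly_disjoint[OF assms(1,2,5,7), where B = "B t" and v = "entry m c t"
            and c = "\<lambda>u. x (t, u)"]) (auto simp: P_def)
    then show "x p = 0" by (simp add: u(1))
  qed
  \<comment> \<open>The sum over basis pairs equals the evaluation of the codeword at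
    \<open>a ^ (b + e)\<close> and \<open>(\<sigma> ^^ e) \<beta>\<close>: \<open>\<sigma>\<close>
    fixes the matrix \<open>A\<close>, and summing over \<open>u\<close> first restores the
    entries.\<close>
  have eqs: "(\<Sum>p\<in>P. Y p * (a ^ (fst p * e) * (\<sigma> ^^ e) (\<gamma> p))) =
      (\<Sum>u<m. \<Sum>t<l. entry m c t u * (a ^ (b + e)) ^ t * (\<sigma> ^^ u) ((\<sigma> ^^ e) \<beta>))" for e
  proof -
    have "(\<Sum>p\<in>P. Y p * (a ^ (fst p * e) * (\<sigma> ^^ e) (\<gamma> p))) =
        (\<Sum>t<l. \<Sum>u\<in>B t. Y (t, u) * (a ^ (t * e) * (\<sigma> ^^ e) (\<gamma> (t, u))))"
      unfolding P_def using fB by (subst sum.Sigma) (auto simp: case_prod_beta)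
    also have "\<dots> = (\<Sum>t<l. \<Sum>j<m. entry m c t j * (a ^ (b + e)) ^ t * (\<sigma> ^^ j) ((\<sigma> ^^ e) \<beta>))"
    proof (rule sum.cong[OF refl])
      fix t
      have "Y (t, u) * (a ^ (t * e) * (\<sigma> ^^ e) (\<gamma> (t, u))) =
          (\<Sum>j<m. (A t u j * entry m c t u) * ((a ^ (b + e)) ^ t * (\<sigma> ^^ j) ((\<sigma> ^^ e) \<beta>)))" for u
      proof -
        have "(\<sigma> ^^ e) (\<gamma> (t, u)) = (\<Sum>j<m. A t u j * (\<sigma> ^^ j) ((\<sigma> ^^ e) \<beta>))"
          unfolding \<gamma>_def using AK \<beta>L
          by (subst S.funpow_sum)
            (auto simp: S.iterate_mult funpow_add[THEN fun_cong, unfolded comp_apply, symmetric]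
              add.commute)
        then show ?thesis
          by (simp add: Y_def sum_distrib_left power_mult[symmetric] power_add algebra_simps)
      qed
      then have "(\<Sum>u\<in>B t. Y (t, u) * (a ^ (t * e) * (\<sigma> ^^ e) (\<gamma> (t, u)))) =
          (\<Sum>j<m. (\<Sum>u\<in>B t. A t u j * entry m c t u) * ((a ^ (b + e)) ^ t * (\<sigma> ^^ j) ((\<sigma> ^^ e) \<beta>)))"
        unfolding sum_distrib_right by (subst sum.swap) simp
      also have "\<dots> = (\<Sum>j<m. entry m c t j * ((a ^ (b + e)) ^ t * (\<sigma> ^^ j) ((\<sigma> ^^ e) \<beta>)))"
        using expand[of _ t] by (intro sum.cong refl) (simp only: lessThan_iff)
      finally show "(\<Sum>u\<in>B t. Y (t, u) * (a ^ (t * e) * (\<sigma> ^^ e) (\<gamma> (t, u)))) =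
          (\<Sum>j<m. entry m c t j * (a ^ (b + e)) ^ t * (\<sigma> ^^ j) ((\<sigma> ^^ e) \<beta>))"
        by (simp add: mult.assoc)
    qed
    also have "\<dots> = (\<Sum>u<m. \<Sum>t<l. entry m c t u * (a ^ (b + e)) ^ t * (\<sigma> ^^ u) ((\<sigma> ^^ e) \<beta>))"
      by (rule sum.swap)
    finally show ?thesis .
  qed
  have "d + r \<le> card P"
  proof (rule S.roos_argument[OF fP \<open>P \<noteq> {}\<close> _ \<gamma>_indep \<gamma>L Y_indep _ assms(9-16)])
    show "fst p < l" if "p \<in> P" for p using that by (auto simp: P_def)
    show "Y p \<in> L" if "p \<in> P" for p
    proof -
      have "entry m c (fst p) (snd p) \<in> L"
        using entryF[of "fst p" "snd p"] assms(5) that by (auto simp: P_def)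
      then show ?thesis using assms(9) by (simp add: Y_def)
    qed
    show "(\<Sum>p\<in>P. Y p * (a ^ (fst p * (s * i + k j)) * (\<sigma> ^^ (s * i + k j)) (\<gamma> p))) = 0"
      if "i < d - 1" "j \<le> r" for i j
      using assms(21)[OF that] eqs by simp
  qed
  also have "card P = (\<Sum>t<l. card (B t))" unfolding P_def using fB by simp
  also have "\<dots> = wt_srk E m l c"
    unfolding wt_srk_def
  proof (rule sum.cong[OF refl], rule sym)
    fix t
    show "ring.dim \<Omega> E (ring.Span \<Omega> E (map (entry m c t) [0..<m])) = card (B t)"
    proof (rule dim_Span_eq_card[where A = "A t", OF assms(3) B AE])
      show "entry m c t j = (\<Sum>u\<in>B t. A t u j * entry m c t u)" if "j < m" for j
        by (rule expand[OF that])
      show "\<forall>u\<in>B t. x u = 0"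
        if "\<And>u. u \<in> B t \<Longrightarrow> x u \<in> E" "(\<Sum>u\<in>B t. x u * entry m c t u) = 0" for x
        by (rule indep[OF that])
    qed
  qed
  finally show ?thesis .
qed

theorem theorem4p4:
  fixes E F K L :: "'a::field set" and \<sigma> \<theta> :: "'a \<Rightarrow> 'a" and h m l n r :: nat
    and C :: "'a vec set" and g :: "'a poly poly"
    and b s \<delta> :: int and k :: "nat \<Rightarrow> int" and a \<beta> :: 'a
  assumes "subfield E \<Omega>" "subfield F \<Omega>" "subfield K \<Omega>" "subfield L \<Omega>"
    and "K \<inter> F = E" and "L = generate_field \<Omega> (F \<union> K)"
    and "ring.dimension \<Omega> h E K" and "ring.dimension \<Omega> m E F"
    and "ring.dimension \<Omega> h F L" and "ring.dimension \<Omega> m K L"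
    and "galois_extension L K" and "cyclic_group (galois_group L K)"
    and "\<sigma> \<in> carrier (galois_group L K)"
    and "\<theta> = restrict \<sigma> F" and "\<theta> \<in> carrier (galois_group F E)"
    and "group.ord (galois_group F E) \<theta> = m" and "{x \<in> F. \<theta> x = x} = E"
    and "l > 0" and "card {x \<in> K. x ^ l = 1} = l"
    and "CHAR('a) > 0 \<longrightarrow> coprime l CHAR('a)" and "coprime l m"
    and "n = m * l"
    and "cyclic_skew_cyclic F \<theta> m l C" and "C \<noteq> {0\<^sub>v n}"
    and "generates_code F \<theta> m l g C"
    and "gcd (int n) s = 1"
    and "\<forall>i<r. k i < k (Suc i)" and "k r - k 0 \<le> \<delta> + int r - 2"
    and "a \<in> K" and "primitive_root_of_unity l a"
    and "normal_element K L \<sigma> m \<beta>"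
    and "{(a powi (b + s * i + k j), (\<sigma> [^]\<^bsub>galois_group L K\<^esub> (s * i + k j)) \<beta>) | i j.
            0 \<le> i \<and> i \<le> \<delta> - 2 \<and> j \<le> r} \<subseteq> defining_set K L \<sigma> l g"
  shows "int (d_srk E m l C) \<ge> \<delta> + int r"
proof -
  interpret R: field "\<Omega> :: 'a ring" by (rule field_from_type_algebra)
  interpret L: ambient_subfield L by (rule ambient_subfield.intro[OF assms(4)])
  interpret F: ambient_subfield F by (rule ambient_subfield.intro[OF assms(2)])
  have "m \<noteq> 0"
  proof
    assume "m = 0"
    then have "F = {0}" using R.dimension_zero[OF assms(1), of F] assms(8) by simp
    then show False using F.closed(2) by simp
  qed
  then have m0: "m > 0" and n0: "n > 0" using assms(18,22) by simp_all
  have sub: "F \<subseteq> L" "K \<subseteq> L" "E \<subseteq> F" "E \<subseteq> K"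
    using assms(5) unfolding assms(6) by (auto intro: generate_field.incl)
  have S0: "subfield_endomorphism L \<sigma>" and \<sigma>K: "\<And>x. x \<in> K \<Longrightarrow> \<sigma> x = x"
    using galois_group_memD[OF assms(4,13)] by blast+
  have T0: "subfield_endomorphism F \<theta>" by (rule galois_group_memD[OF assms(2,15)])
  interpret S0: subfield_endomorphism L \<sigma> by (rule S0)
  interpret T0: subfield_endomorphism F \<theta> by (rule T0)
  interpret GF: group "galois_group F E" by (rule group_galois_group[OF assms(2) sub(3)])
  have \<theta>\<sigma>: "\<theta> x = \<sigma> x" if "x \<in> F" for x using that by (simp add: assms(14))
  have \<theta>m: "(\<theta> ^^ m) x = x" if "x \<in> F" for x
    using GF.pow_ord_eq_1[OF assms(15)] galois_group_pow[OF assms(2,15) that sub(3), of m] that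
    by (simp add: assms(16)) (simp add: galois_group_def BijGroup_def)
  have pow: "(\<theta> ^^ i) x = (\<sigma> ^^ i) x" if "x \<in> F" for x i
  proof (induction i)
    case (Suc i)
    then show ?case using \<theta>\<sigma>[OF T0.funpow_closed[OF that, of i]] by simp
  qed simp
  have T: "subfield_automorphism F E \<theta> m"
    using \<theta>m assms(17) by unfold_locales
  have \<sigma>m: "(\<sigma> ^^ m) x = x" if "x \<in> L" for x
  proof (rule iterate_period_generate_field[OF S0 assms(6) _ that])
    fix x assume "x \<in> F \<union> K"
    then show "(\<sigma> ^^ m) x = x"
    proof
      assume "x \<in> F"
      then show ?thesis using \<theta>m pow by metis
    next
      assume "x \<in> K"
      then show ?thesis by (induction m) (auto simp: \<sigma>K)
    qed
  qed
  \<comment> \<open>That the fixed field of this particular \<open>\<sigma>\<close> is exactly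
    \<open>K\<close> is read off the normal basis generated by \<open>\<beta>\<close>.\<close>
  have S: "subfield_automorphism L K \<sigma> m"
    by (rule subfield_automorphism_of_normal_element[OF S0 \<sigma>K sub(2) assms(3) \<sigma>m assms(31) m0])
  interpret S: subfield_automorphism L K \<sigma> m by (rule S)
  have al: "a ^ l = 1" using assms(30) by (simp add: primitive_root_of_unity_def)
  have \<beta>L: "\<beta> \<in> L" using assms(31) by (simp add: normal_element_def)

  have k_less: "k i < k j" if "i < j" "j \<le> r" for i j
    using that
  proof (induction j)
    case (Suc j)
    have "k j < k (Suc j)" using assms(27) Suc.prems by simp
    then show ?case using Suc by (cases "i = j") auto
  qed simp
  have k_ge: "k 0 + int j \<le> k j" if "j \<le> r" for j
    using that
  proof (induction j)
    case (Suc j)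
    then show ?case using k_less[of j "Suc j"] by simp
  qed simp
  have \<delta>2: "\<delta> \<ge> 2" using k_ge[of r] assms(28) by simp
  define d where "d = nat \<delta>"
  have d: "int d = \<delta>" using \<delta>2 by (simp add: d_def)
  \<comment> \<open>A multiple of \<open>n\<close> that is at least \<open>\<bar>k 0\<bar>\<close>.
    Adding it to all \<open>k j\<close> makes them nonnegative, keeps their differences, and changes
    neither the powers of \<open>a\<close> nor those of \<open>\<sigma>\<close>.\<close>
  define M where "M = n * nat \<bar>k 0\<bar>"
  define k' where "k' j = nat (k j + int M)" for j
  define s' where "s' = nat (s mod int n)"
  define b' where "b' = nat (b mod int n)"
  have "\<bar>k 0\<bar> \<le> int M"
    using n0 mult_right_mono[of 1 "int n" "\<bar>k 0\<bar>"] by (simp add: M_def)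
  then have k': "int (k' j) = k j + int M" if "j \<le> r" for j
    using k_ge[OF that] by (simp add: k'_def)
  have s': "int s' = s mod int n" and b': "int b' = b mod int n"
    using n0 by (simp_all add: s'_def b'_def)
  have "coprime (int s') (int n)"
    using assms(26) gcd_red_int[of s "int n"] by (simp add: s' coprime_iff_gcd_eq_1 gcd.commute)
  then have "coprime s' n" by simp
  then have s'_coprime: "coprime s' m" "coprime s' l" by (simp_all add: assms(22))
  \<comment> \<open>Congruence modulo \<open>n = m * l\<close> serves twice: modulo \<open>l\<close>
    for exponents of \<open>a\<close> and modulo \<open>m\<close> for exponents of
    \<open>\<sigma>\<close>.\<close>
  have cong_e: "[s * int i + k j = int (s' * i + k' j)] (mod int n)" if "j \<le> r" for i j
  proof -
    have "[s * int i + k j + 0 = (s mod int n) * int i + k j + int M] (mod int n)"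
      by (intro cong_add cong_mult cong_refl) (auto simp: cong_def M_def)
    then show ?thesis using k'[OF that] by (simp add: s' algebra_simps)
  qed
  have cong_be: "[b + s * int i + k j = int (b' + (s' * i + k' j))] (mod int n)" if "j \<le> r" for i j
  proof -
    have "[b + (s * int i + k j) = b mod int n + int (s' * i + k' j)] (mod int n)"
      by (intro cong_add cong_e[OF that]) (simp add: cong_def)
    then show ?thesis by (simp add: b' add.assoc)
  qed
  have code: "linear_code F n C" using assms(22,23) by (simp add: cyclic_skew_cyclic_def)
  have entryF: "entry m c t u \<in> F" if "c \<in> C" "t < l" "u < m" for c t u
  proof -
    have "t * m + u < Suc t * m" using that(3) by simp
    also have "\<dots> \<le> l * m" using that(2) by (intro mult_le_mono1) simp
    finally show ?thesis
      using code that(1) by (auto simp: linear_code_def entry_def assms(22) mult.commute)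
  qed
  have dvd: "int m dvd int n" "int l dvd int n" by (simp_all add: assms(22))
  have zero: "(\<Sum>u<m. \<Sum>t<l. entry m c t u * (a ^ (b' + (s' * i + k' j))) ^ t *
      (\<sigma> ^^ u) ((\<sigma> ^^ (s' * i + k' j)) \<beta>)) = 0"
    if c: "c \<in> C" and ij: "i < d - 1" "j \<le> r" for c i j
  proof -
    let ?e = "s' * i + k' j"
    have "(a powi (b + s * int i + k j), (\<sigma> [^]\<^bsub>galois_group L K\<^esub> (s * int i + k j)) \<beta>)
        \<in> defining_set K L \<sigma> l g"
      using ij d by (intro subsetD[OF assms(32)] CollectI exI[of _ "int i"] exI[of _ j]) auto
    moreover have "a powi (b + s * int i + k j) = a ^ (b' + ?e)"
      by (rule power_int_eq_power_of_cong[OF al assms(18) cong_dvd_modulus[OF cong_be[OF ij(2)] dvd(2)]])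
    moreover have "(\<sigma> [^]\<^bsub>galois_group L K\<^esub> (s * int i + k j)) \<beta> = (\<sigma> ^^ ?e) \<beta>"
      by (rule galois_group_int_pow_cong[OF assms(4,13) \<beta>L sub(2) \<sigma>m
            cong_dvd_modulus[OF cong_e[OF ij(2)] dvd(1)]])
    ultimately have "Ev \<sigma> (a ^ (b' + ?e)) ((\<sigma> ^^ ?e) \<beta>) g = 0" "(\<sigma> ^^ ?e) \<beta> \<noteq> 0"
      by (auto simp: defining_set_def)
    \<comment> \<open>The common factor \<open>inverse ((\<sigma> ^^ ?e) \<beta>)\<close> of
      \<open>Ev\<close> is nonzero and can be cancelled.\<close>
    then have "(\<Sum>j\<le>Polynomial.degree g. poly (poly.coeff g j) (a ^ (b' + ?e)) *
        (\<sigma> ^^ j) ((\<sigma> ^^ ?e) \<beta>)) = 0"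
      by (simp add: Ev_def sum_distrib_right[symmetric])
    moreover have "(a ^ (b' + ?e)) ^ l = 1"
      by (metis al power_mult mult.commute power_one)
    ultimately show ?thesis
      using assms(29) \<beta>L entryF[OF c]
      by (intro codeword_evaluation_zero[OF S T m0 sub(1) \<theta>\<sigma> _ _ assms(25) c]) simp_all
  qed
  have bound: "d + r \<le> wt_srk E m l c" if c: "c \<in> C" "c \<noteq> 0\<^sub>v n" for c
  proof -
    have "dim_vec c = n" using code c(1) by (auto simp: linear_code_def)
    then obtain t where t: "t < n" "c $ t \<noteq> 0" using c(2) by (metis eq_vecI index_zero_vec)
    have t': "t div m < l" "t mod m < m" "entry m c (t div m) (t mod m) \<noteq> 0"
      using t m0 by (simp_all add: entry_def assms(22) less_mult_imp_div_less mult.commute)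
    show ?thesis
    proof (rule wt_srk_ge[OF S T assms(1,3) sub(1,4) \<theta>\<sigma> assms(31,29,30) m0 s'_coprime _ _ _
          entryF[OF c(1)] t' zero[OF c(1)]])
      show "coprime m l" using assms(21) by (simp add: coprime_commute)
      show "k' i < k' j" if "i < j" "j \<le> r" for i j
        using k_less[OF that] k'[of i] k'[of j] that by simp
      show "k' r + 2 \<le> k' 0 + d + r"
        using k'[of r] k'[of 0] assms(28) d by simp
    qed
  qed
  \<comment> \<open>A nonzero codeword makes the set of weights nonempty, so that its infimum is
    bounded below by every common lower bound.\<close>
  have "0\<^sub>v n \<in> C" using code by (simp add: linear_code_def)
  then obtain c where "c \<in> C" "c \<noteq> 0\<^sub>v n" using assms(24) by blast
  then have "d + r \<le> d_srk E m l C"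
    unfolding d_srk_def using bound by (intro cInf_greatest) (auto simp: assms(22))
  then show ?thesis using d by simp
qed

end
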